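(* Fix $k\in\{1,2,\dots\}\cup\{\infty\}$. For $a>0$ let $\mathcal{S}_a$ be the $C^k$-structure on $\mathbb{L}$ given by the special minimal atlas of $w_a$. Then: (1) If $a=1$ (so $w_1=\mathrm{id}_{\mathbb{R}}$), there is a group isomorphism $\eta\colon \mathrm{Diff}(\mathcal{S}_1)\to D^k(\mathbb{R},0)\times\mathbb{Z}_2$ (with $\mathbb{Z}_2=\{\pm1\}$) such that for $*\in\{+,-\}$: $\eta(\mathrm{Diff}^{*,\mathrm{fix}}(\mathcal{S}_1))=D^{k,*}(\mathbb{R},0)\times\{1\}$ and $\eta(\mathrm{Diff}^{*,\mathrm{ex}}(\mathcal{S}_1))=D^{k,*}(\mathbb{R},0)\times\{-1\}$. (2) If $a\neq1$, then $\mathrm{Diff}^{+,\mathrm{ex}}(\mathcal{S}_a)=\mathrm{Diff}^{-,\mathrm{fix}}(\mathcal{S}_a)=\varnothing$ and $\mathrm{Diff}(\mathcal{S}_a)=\mathrm{Diff}^{+,\mathrm{fix}}(\mathcal{S}_a)\sqcup\mathrm{Diff}^{-,\mathrm{ex}}(\mathcal{S}_a)$. Moreover there is a group isomorphism $\mathrm{Diff}^{+,\mathrm{fix}}(\mathcal{S}_a)\cong E^{k,+}(\mathbb{R},0)$, and there exists an element $p\in\mathrm{Diff}^{-,\mathrm{ex}}(\mathcal{S}_a)$ of order $2$; hence $\mathrm{Diff}(\mathcal{S}_a)$ splits as a semidirect product $\mathrm{Diff}^{+,\mathrm{fix}}(\mathcal{S}_a)\rtimes\langle p\rangle$, and so is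 isomorphic to some semidirect product $E^{k,+}(\mathbb{R},0)\rtimes\mathbb{Z}_2$. (3) If $a\neq 1$, then $\mathcal{S}_a$ and $\mathcal{S}_{1/a}$ are $C^k$-diffeomorphic; more precisely $\mathrm{Diff}^{+,\mathrm{fix}}(\mathcal{S}_a,\mathcal{S}_{1/a})=\mathrm{Diff}^{-,\mathrm{ex}}(\mathcal{S}_a,\mathcal{S}_{1/a})=\varnothing$, $\mathrm{Diff}(\mathcal{S}_a,\mathcal{S}_{1/a})=\mathrm{Diff}^{+,\mathrm{ex}}(\mathcal{S}_a,\mathcal{S}_{1/a})\sqcup\mathrm{Diff}^{-,\mathrm{fix}}(\mathcal{S}_a,\mathcal{S}_{1/a})$, and for every $h\in\mathrm{Diff}^{-,\mathrm{fix}}(\mathcal{S}_a,\mathcal{S}_{1/a})$ and $g\in\mathrm{Diff}^{+,\mathrm{ex}}(\mathcal{S}_a,\mathcal{S}_{1/a})$ the maps $\kappa\mapsto g^{-1}\circ\kappa$ and $\kappa\mapsto h\circ\kappa$ are bijections $\mathrm{Diff}^{+,\mathrm{ex}}(\mathcal{S}_a,\mathcal{S}_{1/a})\to\mathrm{Diff}^{+,\mathrm{fix}}(\mathcal{S}_a)$ and $\mathrm{Diff}^{+,\mathrm{fix}}(\mathcal{S}_a)\to\mathrm{Diff}^{-,\mathrm{fix}}(\mathcal{S}_a,\mathcal{S}_{1/a})$ respectively. (4) If $a,b>0$ with $a\neq b$ and $a\neq 1/b$, then $\mathrm{Diff}(\mathcal{S}_a,\mathcal{S}_b)=\varnothing$.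 In particular, $\mathbb{L}$ has uncountably many pairwise non-diffeomorphic $C^k$-structures.
   Context: $\mathbb{L}=\mathbb{R}\sqcup\{0'\}$ is the line with two origins: its open sets are the open subsets of $\mathbb{R}$ and the sets $(W\setminus\{0\})\cup\{0'\}$ with $W\subset\mathbb{R}$ open, $0\in W$. Put $U=\mathbb{L}\setminus\{0'\}=\mathbb{R}$, $V=\mathbb{L}\setminus\{0\}$. $C^k$-atlases, $C^k$-structures (equivalence classes of atlases whose union is again a $C^k$-atlas) and $C^k$-diffeomorphisms between structures on $\mathbb{L}$ are defined via charts (homeomorphisms of open subsets of $\mathbb{L}$ onto open subsets of $\mathbb{R}$) as for manifolds. Every homeomorphism of $\mathbb{L}$ either fixes both $0,0'$ or exchanges them, and maps $\mathbb{R}\setminus\{0\}$ onto itself; it preserves (reverses) orientation if its restriction to $\mathbb{R}\setminus\{0\}$ is increasing (decreasing). For structures $\mathcal{S},\mathcal{T}$: $\mathrm{Diff}(\mathcal{S},\mathcal{T})$ is the set of $C^k$-diffeomorphisms $(\mathbb{L},\mathcal{S})\to(\mathbb{L},\mathcal{T})$; $\mathrm{Diff}^{*,\bullet}(\mathcal{S},\mathcal{T})$, $*\in\{+,-\}$, $\bullet\in\{\mathrm{fix},\mathrm{ex}\}$, the subset of those preserving ($+$) / reversing ($-$) orientation and fixing ($\mathrm{fix}$) / exchanging ($\mathrm{ex}$) $0$ and $0'$; $\mathrm{Diff}(\mathcal{S})=\mathrm{Diff}(\mathcal{S},\mathcal{S})$ etc. $H^k(\mathbb{R},0)$: homeomorphisms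 $h$ of $\mathbb{R}$ with $h(0)=0$ restricting to a $C^k$-diffeomorphism of $\mathbb{R}\setminus\{0\}$. $D^k(\mathbb{R},0)$: $C^k$-diffeomorphisms of $\mathbb{R}$ fixing $0$; $D^{k,+}$, $D^{k,-}$ its orientation preserving / reversing elements. $E^{k,+}(\mathbb{R},0)$: orientation preserving $h\in D^k(\mathbb{R},0)$ with $h^{(i)}(0)=0$ for all integers $2\le i\le k$ (all $i\ge2$ if $k=\infty$). Let $\mathrm{id}_U\colon U\to\mathbb{R}$ be the identity and $\mathrm{id}_V\colon V\to\mathbb{R}$ be $\mathrm{id}_V(0')=0$, $\mathrm{id}_V(x)=x$ for $x\ne0'$. For $h\in H^k(\mathbb{R},0)$ the special minimal atlas of $h$ is the $C^k$-atlas $\{(U,\mathrm{id}_U),(V,h\circ\mathrm{id}_V)\}$. For $a>0$, $w_a\in H^k(\mathbb{R},0)$ is $w_a(x)=x$ for $x\le0$ and $w_a(x)=ax$ for $x>0$. *)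

theory Defs
  imports "HOL-Analysis.Analysis" "HOL-Library.Extended_Nat"
begin

section \<open>The line with two origins\<close>

text \<open>Points of L: Pt x for x real (so Pt 0 is the origin 0), and Org2 (the second origin 0').\<close>
datatype L = Pt real | Org2

definition Lopen :: "L set \<Rightarrow> bool" where
  "Lopen S \<longleftrightarrow> open (Pt -` S) \<and> (Org2 \<in> S \<longrightarrow> open (insert 0 (Pt -` S)))"

lemma istopology_Lopen: "istopology Lopen"
  unfolding istopology_def
proof (intro conjI allI impI ballI)
  fix S T assume S: "Lopen S" and T: "Lopen T"
  show "Lopen (S \<inter> T)"
  proof -
    have "Pt -` (S \<inter> T) = Pt -` S \<inter> Pt -` T" by auto
    moreover have "insert 0 (Pt -` (S \<inter> T)) = insert 0 (Pt -` S) \<inter> insert 0 (Pt -` T)" by auto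
    ultimately show ?thesis using S T unfolding Lopen_def by (metis IntE open_Int)
  qed
next
  fix K assume K: "\<forall>S\<in>K. Lopen S"
  show "Lopen (\<Union>K)"
    unfolding Lopen_def
  proof (intro conjI impI)
    have "Pt -` (\<Union>K) = (\<Union>S\<in>K. Pt -` S)" by auto
    then show "open (Pt -` \<Union>K)" using K unfolding Lopen_def by auto
  next
    assume "Org2 \<in> \<Union>K"
    then obtain S0 where S0: "S0 \<in> K" "Org2 \<in> S0" by auto
    have "insert 0 (Pt -` \<Union>K) = insert 0 (Pt -` S0) \<union> (\<Union>S\<in>K. Pt -` S)" using S0 by auto
    moreover have "open (\<Union>S\<in>K. Pt -` S)" using K unfolding Lopen_def by auto
    moreover have "open (insert 0 (Pt -` S0))" using K S0 unfolding Lopen_def by auto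
    ultimately show "open (insert 0 (Pt -` \<Union>K))" by (metis open_Un)
  qed
qed

definition Ltop :: "L topology" where "Ltop = topology Lopen"

text \<open>The maps id_U and id_V (both are this map restricted to U resp. V).\<close>
fun real_of_L :: "L \<Rightarrow> real" where
  "real_of_L (Pt x) = x" | "real_of_L Org2 = 0"

definition LU :: "L set" where "LU = range Pt"
definition LV :: "L set" where "LV = - {Pt 0}"

section \<open>C^k functions of one real variable (k a positive natural number or infinity)\<close>

definition Cn_on :: "nat \<Rightarrow> real set \<Rightarrow> (real \<Rightarrow> real) \<Rightarrow> bool" where
  "Cn_on n S f \<longleftrightarrow> (\<exists>D :: nat \<Rightarrow> real \<Rightarrow> real.
      (\<forall>x\<in>S. D 0 x = f x) \<and>
      (\<forall>i<n. \<forall>x\<in>S. (D i has_real_derivative D (Suc i) x) (at x within S)) \<and>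
      continuous_on S (D n))"

definition Ck_on :: "enat \<Rightarrow> real set \<Rightarrow> (real \<Rightarrow> real) \<Rightarrow> bool" where
  "Ck_on k S f \<longleftrightarrow> (\<forall>n::nat. enat n \<le> k \<longrightarrow> Cn_on n S f)"

section \<open>Charts, atlases, structures on L\<close>

type_synonym chart = "L set \<times> (L \<Rightarrow> real)"

definition is_chart :: "chart \<Rightarrow> bool" where
  "is_chart c \<longleftrightarrow> (case c of (U, \<phi>) \<Rightarrow>
     Lopen U \<and> open (\<phi> ` U) \<and>
     homeomorphic_map (subtopology Ltop U) (subtopology euclideanreal (\<phi> ` U)) \<phi>)"

text \<open>Transition map psi o phi^-1 : phi(U \<inter> V) \<rightarrow> psi(U \<inter> V) is C^k.\<close>
definition Ck_compatible :: "enat \<Rightarrow> chart \<Rightarrow> chart \<Rightarrow> bool" where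
  "Ck_compatible k c d \<longleftrightarrow> (case c of (U, \<phi>) \<Rightarrow> case d of (V, \<psi>) \<Rightarrow>
     Ck_on k (\<phi> ` (U \<inter> V)) (\<psi> \<circ> inv_into U \<phi>))"

definition Ck_atlas :: "enat \<Rightarrow> chart set \<Rightarrow> bool" where
  "Ck_atlas k A \<longleftrightarrow> (\<forall>c\<in>A. is_chart c) \<and> \<Union> (fst ` A) = UNIV \<and>
     (\<forall>c\<in>A. \<forall>d\<in>A. Ck_compatible k c d)"

text \<open>The C^k-structure determined by an atlas A: its equivalence class of atlases.\<close>
definition Ck_struct_of :: "enat \<Rightarrow> chart set \<Rightarrow> chart set set" where
  "Ck_struct_of k A = {B. Ck_atlas k B \<and> Ck_atlas k (A \<union> B)}"

definition is_Ck_structure :: "enat \<Rightarrow> chart set set \<Rightarrow> bool" where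
  "is_Ck_structure k S \<longleftrightarrow> (\<exists>A. Ck_atlas k A \<and> S = Ck_struct_of k A)"

section \<open>Diffeomorphisms\<close>

text \<open>f is C^k from S to T: in all charts of the (maximal atlases of the) structures.\<close>
definition Ck_map :: "enat \<Rightarrow> chart set set \<Rightarrow> chart set set \<Rightarrow> (L \<Rightarrow> L) \<Rightarrow> bool" where
  "Ck_map k S T f \<longleftrightarrow> (\<forall>(U, \<phi>)\<in>\<Union>S. \<forall>(V, \<psi>)\<in>\<Union>T.
     Ck_on k (\<phi> ` (U \<inter> f -` V)) (\<psi> \<circ> f \<circ> inv_into U \<phi>))"

definition Diff :: "enat \<Rightarrow> chart set set \<Rightarrow> chart set set \<Rightarrow> (L \<Rightarrow> L) set" where
  "Diff k S T = {f. homeomorphic_map Ltop Ltop f \<and> Ck_map k S T f \<and> Ck_map k T S (inv f)}"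

definition orient_pres :: "(L \<Rightarrow> L) \<Rightarrow> bool" where
  "orient_pres f \<longleftrightarrow> strict_mono_on (- {0}) (\<lambda>x. real_of_L (f (Pt x)))"

definition orient_rev :: "(L \<Rightarrow> L) \<Rightarrow> bool" where
  "orient_rev f \<longleftrightarrow> strict_antimono_on (- {0}) (\<lambda>x. real_of_L (f (Pt x)))"

definition fixes_origins :: "(L \<Rightarrow> L) \<Rightarrow> bool" where
  "fixes_origins f \<longleftrightarrow> f (Pt 0) = Pt 0 \<and> f Org2 = Org2"

definition exchanges_origins :: "(L \<Rightarrow> L) \<Rightarrow> bool" where
  "exchanges_origins f \<longleftrightarrow> f (Pt 0) = Org2 \<and> f Org2 = Pt 0"

text \<open>Diff^{*,bullet}(S,T): pos = True means +, fx = True means fix.\<close>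
definition Diff_sub :: "enat \<Rightarrow> bool \<Rightarrow> bool \<Rightarrow> chart set set \<Rightarrow> chart set set \<Rightarrow> (L \<Rightarrow> L) set" where
  "Diff_sub k pos fx S T = {f \<in> Diff k S T.
     (if pos then orient_pres f else orient_rev f) \<and>
     (if fx then fixes_origins f else exchanges_origins f)}"

section \<open>Groups of germs at 0 on the real line\<close>

definition Dk :: "enat \<Rightarrow> (real \<Rightarrow> real) set" where
  "Dk k = {h. bij h \<and> h 0 = 0 \<and> Ck_on k UNIV h \<and> Ck_on k UNIV (inv h)}"

definition Dk_plus :: "enat \<Rightarrow> (real \<Rightarrow> real) set" where
  "Dk_plus k = {h \<in> Dk k. strict_mono h}"

definition Dk_minus :: "enat \<Rightarrow> (real \<Rightarrow> real) set" where
  "Dk_minus k = {h \<in> Dk k. strict_antimono_on UNIV h}"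

definition Ek_plus :: "enat \<Rightarrow> (real \<Rightarrow> real) set" where
  "Ek_plus k = {h \<in> Dk_plus k. \<forall>i::nat. 2 \<le> i \<and> enat i \<le> k \<longrightarrow> (deriv ^^ i) h 0 = 0}"

definition Z2 :: "int set" where "Z2 = {1, -1}"

section \<open>Special minimal atlases and the structures S_a\<close>

definition special_atlas :: "(real \<Rightarrow> real) \<Rightarrow> chart set" where
  "special_atlas h = {(LU, real_of_L), (LV, h \<circ> real_of_L)}"

definition w :: "real \<Rightarrow> real \<Rightarrow> real" where
  "w a x = (if x \<le> 0 then x else a * x)"

definition S_a :: "enat \<Rightarrow> real \<Rightarrow> chart set set" where
  "S_a k a = Ck_struct_of k (special_atlas (w a))"

end

theory Submission
  imports Defs
begin

text \<open>A homeomorphism \<open>f\<close> of the line with two origins is determined by the homeomorphism \<open>h\<close> of \<open>\<real>\<close> it induces,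
  which fixes \<open>0\<close>, and by whether it fixes or exchanges the origins. In charts, \<open>f\<close> is a diffeomorphism from
  \<open>S_a\<close> to \<open>S_b\<close> iff \<open>h\<close> and \<open>w b \<circ> h \<circ> w (1/a)\<close> are diffeomorphisms of \<open>\<real>\<close> (origins fixed), respectively
  \<open>w b \<circ> h\<close> and \<open>h \<circ> w (1/a)\<close> are (origins exchanged). If \<open>h\<close> is increasing with \<open>i\<close>-th derivative \<open>d\<close> at \<open>0\<close>,
  then \<open>w b \<circ> h \<circ> w (1/a)\<close> has left derivative \<open>d\<close> and right derivative \<open>b d / a^i\<close>; the first order
  forces \<open>a = b\<close>, and for \<open>a \<noteq> 1\<close> the higher orders force \<open>d = 0\<close>, which conversely suffices to glue.
  For decreasing \<open>h\<close> the slopes force \<open>a = 1/b\<close>, and exchanging the origins replaces \<open>b\<close> by \<open>1/b\<close>.\<close>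

section \<open>Calculus of \<open>C\<^sup>k\<close> functions\<close>

lemma Cn_on_cong:
  assumes "\<And>x. x \<in> S \<Longrightarrow> f x = g x"
  shows "Cn_on n S f \<longleftrightarrow> Cn_on n S g"
  using assms unfolding Cn_on_def by simp

lemma Cn_on_subset:
  assumes "Cn_on n S f" "T \<subseteq> S"
  shows "Cn_on n T f"
proof -
  obtain D where "\<forall>x\<in>S. D 0 x = f x"
    "\<forall>i<n. \<forall>x\<in>S. (D i has_real_derivative D (Suc i) x) (at x within S)" "continuous_on S (D n)"
    using assms(1) unfolding Cn_on_def by blast
  with assms(2) show ?thesis
    unfolding Cn_on_def
    by (intro exI[of _ D]) (blast intro: DERIV_subset continuous_on_subset)
qed

lemma Cn_on_0: "Cn_on 0 S f \<longleftrightarrow> continuous_on S f"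
proof
  assume "Cn_on 0 S f"
  then obtain D :: "nat \<Rightarrow> real \<Rightarrow> real" where "\<forall>x\<in>S. D 0 x = f x" "continuous_on S (D 0)"
    unfolding Cn_on_def by blast
  then show "continuous_on S f" by (simp cong: continuous_on_cong)
qed (auto simp: Cn_on_def)

text \<open>The recursive form of the derivative tower; sums, products, compositions and reciprocals
  are handled by induction on it. On an open set \<open>at x within S\<close> is
  \<open>at x\<close>, so ordinary derivatives suffice.\<close>

lemma Cn_on_Suc:
  assumes "open S"
  shows "Cn_on (Suc n) S f \<longleftrightarrow>
    (\<exists>f'. (\<forall>x\<in>S. (f has_real_derivative f' x) (at x)) \<and> Cn_on n S f')"
proof
  assume "Cn_on (Suc n) S f"
  then obtain D where D: "\<forall>x\<in>S. D 0 x = f x"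
    "\<forall>i<Suc n. \<forall>x\<in>S. (D i has_real_derivative D (Suc i) x) (at x within S)"
    "continuous_on S (D (Suc n))"
    unfolding Cn_on_def by blast
  have "(f has_real_derivative D 1 x) (at x)" if "x \<in> S" for x
  proof -
    have "(D 0 has_real_derivative D 1 x) (at x)"
      using D(2) that at_within_open[OF that assms] by force
    then show ?thesis
      using that D(1) assms by (auto elim!: has_field_derivative_transform_within_open)
  qed
  moreover have "Cn_on n S (D 1)"
    unfolding Cn_on_def using D by (intro exI[of _ "\<lambda>i. D (Suc i)"]) auto
  ultimately show "\<exists>f'. (\<forall>x\<in>S. (f has_real_derivative f' x) (at x)) \<and> Cn_on n S f'" by blast
next
  assume "\<exists>f'. (\<forall>x\<in>S. (f has_real_derivative f' x) (at x)) \<and> Cn_on n S f'"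
  then obtain f' D where f': "\<forall>x\<in>S. (f has_real_derivative f' x) (at x)" and D: "\<forall>x\<in>S. D 0 x = f' x"
    "\<forall>i<n. \<forall>x\<in>S. (D i has_real_derivative D (Suc i) x) (at x within S)"
    "continuous_on S (D n)"
    unfolding Cn_on_def by blast
  show "Cn_on (Suc n) S f"
    unfolding Cn_on_def
  proof (intro exI[of _ "\<lambda>i. case i of 0 \<Rightarrow> f | Suc j \<Rightarrow> D j"] conjI ballI allI impI)
    fix i x assume "i < Suc n" "x \<in> S"
    then show "((case i of 0 \<Rightarrow> f | Suc j \<Rightarrow> D j) has_real_derivative
        (case Suc i of 0 \<Rightarrow> f | Suc j \<Rightarrow> D j) x) (at x within S)"
      using f' D by (cases i) (auto intro: has_field_derivative_at_within)
  qed (use D in auto)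
qed

lemma Cn_on_mono:
  assumes "Cn_on n S f" "m \<le> n"
  shows "Cn_on m S f"
proof -
  obtain D where D: "\<forall>x\<in>S. D 0 x = f x"
    "\<forall>i<n. \<forall>x\<in>S. (D i has_real_derivative D (Suc i) x) (at x within S)" "continuous_on S (D n)"
    using assms(1) unfolding Cn_on_def by blast
  have "continuous_on S (D m)"
    using D assms(2) DERIV_continuous_on[of S "D m" "D (Suc m)"] by (cases "m = n") auto
  with D assms(2) show ?thesis unfolding Cn_on_def by (intro exI[of _ D]) auto
qed

lemma Cn_on_const: "Cn_on n S (\<lambda>x. c)"
  unfolding Cn_on_def by (intro exI[of _ "\<lambda>i x. if i = 0 then c else 0"]) auto

lemma Cn_on_id:
  assumes "open S"
  shows "Cn_on n S (\<lambda>x. x)"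
proof (cases n)
  case (Suc m)
  then show ?thesis
    using Cn_on_Suc[OF assms, of m "\<lambda>x. x"] Cn_on_const[of m S 1]
    by (auto intro!: exI[of _ "\<lambda>_. 1"])
qed (simp add: Cn_on_0)

lemma Cn_on_add:
  assumes "open S" "Cn_on n S f" "Cn_on n S g"
  shows "Cn_on n S (\<lambda>x. f x + g x)"
  using assms(2,3)
proof (induction n arbitrary: f g)
  case 0
  then show ?case by (simp add: Cn_on_0 continuous_on_add)
next
  case (Suc n)
  obtain f' g' where f: "\<forall>x\<in>S. (f has_real_derivative f' x) (at x)" "Cn_on n S f'"
    and g: "\<forall>x\<in>S. (g has_real_derivative g' x) (at x)" "Cn_on n S g'"
    using Suc.prems Cn_on_Suc[OF assms(1)] by blast
  show ?case
    unfolding Cn_on_Suc[OF assms(1)]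
    using f g Suc.IH by (intro exI[of _ "\<lambda>x. f' x + g' x"]) (auto intro: DERIV_add)
qed

lemma Cn_on_mult:
  assumes "open S" "Cn_on n S f" "Cn_on n S g"
  shows "Cn_on n S (\<lambda>x. f x * g x)"
  using assms(2,3)
proof (induction n arbitrary: f g)
  case 0
  then show ?case by (simp add: Cn_on_0 continuous_on_mult)
next
  case (Suc n)
  obtain f' g' where f: "\<forall>x\<in>S. (f has_real_derivative f' x) (at x)" "Cn_on n S f'"
    and g: "\<forall>x\<in>S. (g has_real_derivative g' x) (at x)" "Cn_on n S g'"
    using Suc.prems Cn_on_Suc[OF assms(1)] by blast
  \<comment> \<open>The product rule multiplies derivatives by undifferentiated factors, so these
    are needed at order \<open>n\<close> as well.\<close>
  have "Cn_on n S f" "Cn_on n S g" using Suc.prems Cn_on_mono[of "Suc n"] by auto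
  with f g Suc.IH have "Cn_on n S (\<lambda>x. f' x * g x + g' x * f x)"
    by (intro Cn_on_add assms(1)) auto
  then show ?case
    unfolding Cn_on_Suc[OF assms(1)] using f g
    by (intro exI[of _ "\<lambda>x. f' x * g x + g' x * f x"]) (auto intro: DERIV_mult)
qed

lemma Cn_on_compose:
  assumes "open S" "open T" "f ` S \<subseteq> T" "Cn_on n S f" "Cn_on n T g"
  shows "Cn_on n S (\<lambda>x. g (f x))"
  using assms(4,5)
proof (induction n arbitrary: g)
  case 0
  then show ?case using assms(3) by (auto simp: Cn_on_0 intro: continuous_on_compose2)
next
  case (Suc n)
  obtain f' g' where f: "\<forall>x\<in>S. (f has_real_derivative f' x) (at x)" "Cn_on n S f'"
    and g: "\<forall>x\<in>T. (g has_real_derivative g' x) (at x)" "Cn_on n T g'"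
    using Suc.prems Cn_on_Suc[OF assms(1)] Cn_on_Suc[OF assms(2)] by blast
  have "Cn_on n S f" using Suc.prems Cn_on_mono[of "Suc n"] by auto
  with f g Suc.IH have "Cn_on n S (\<lambda>x. g' (f x) * f' x)"
    by (intro Cn_on_mult assms(1)) auto
  then show ?case
    unfolding Cn_on_Suc[OF assms(1)] using f g assms(3)
    by (intro exI[of _ "\<lambda>x. g' (f x) * f' x"]) (blast intro: DERIV_chain2[of g])
qed

text \<open>The derivative of 1/f is -f' times the square of 1/f, so 1/f at order \<open>n\<close>
  controls its own derivative at order \<open>n\<close>; the induction runs with \<open>f\<close>
  fixed.\<close>

lemma Cn_on_inverse:
  assumes "open S" "\<And>x. x \<in> S \<Longrightarrow> f x \<noteq> 0" "Cn_on n S f"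
  shows "Cn_on n S (\<lambda>x. inverse (f x))"
  using assms(3)
proof (induction n)
  case 0
  then show ?case using assms(2) by (auto simp: Cn_on_0 intro: continuous_on_inverse)
next
  case (Suc n)
  obtain f' where f: "\<forall>x\<in>S. (f has_real_derivative f' x) (at x)" "Cn_on n S f'"
    using Suc.prems Cn_on_Suc[OF assms(1)] by blast
  have "Cn_on n S (\<lambda>x. inverse (f x))" using Suc Cn_on_mono[of "Suc n"] by auto
  with f have "Cn_on n S (\<lambda>x. (-1) * (inverse (f x) * f' x * inverse (f x)))"
    by (intro Cn_on_mult Cn_on_const assms(1)) auto
  then show ?case
    unfolding Cn_on_Suc[OF assms(1)] using f assms(2)
    by (intro exI[of _ "\<lambda>x. (-1) * (inverse (f x) * f' x * inverse (f x))"])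
       (auto intro!: derivative_eq_intros)
qed

section \<open>Iterated derivatives and the local nature of C^n\<close>

lemma deriv_funpow_cong_open:
  fixes f g :: "real \<Rightarrow> real"
  assumes "open S" "\<And>x. x \<in> S \<Longrightarrow> f x = g x" "x \<in> S"
  shows "(deriv ^^ i) f x = (deriv ^^ i) g x"
  using assms(3)
proof (induction i arbitrary: x)
  case (Suc i)
  have "\<forall>\<^sub>F y in nhds x. (deriv ^^ i) f y = (deriv ^^ i) g y"
    using Suc assms(1) eventually_nhds by blast
  then show ?case by (simp add: deriv_cong_ev)
qed (use assms(2) in simp)

text \<open>On an open set the derivative tower in \<open>Cn_on\<close> is unique and consists of
  the iterated \<open>deriv\<close>. This canonical choice lets towers found on different
  neighbourhoods be patched.\<close>

lemma Cn_on_iff_deriv: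
  assumes S: "open S"
  shows "Cn_on n S f \<longleftrightarrow>
    (\<forall>i<n. \<forall>x\<in>S. ((deriv ^^ i) f has_real_derivative (deriv ^^ Suc i) f x) (at x)) \<and>
    continuous_on S ((deriv ^^ n) f)"
proof
  assume "Cn_on n S f"
  then obtain D where D: "\<forall>x\<in>S. D 0 x = f x"
    "\<forall>i<n. \<forall>x\<in>S. (D i has_real_derivative D (Suc i) x) (at x within S)" "continuous_on S (D n)"
    unfolding Cn_on_def by blast
  have D': "(D i has_real_derivative D (Suc i) x) (at x)" if "i < n" "x \<in> S" for i x
    using D(2) that at_within_open[OF _ S] by force
  have eq: "i \<le> n \<Longrightarrow> \<forall>x\<in>S. (deriv ^^ i) f x = D i x" for i
  proof (induction i)
    case (Suc i)
    have "((deriv ^^ i) f has_real_derivative D (Suc i) x) (at x)" if "x \<in> S" for x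
      using has_field_derivative_transform_within_open[OF D' S that] Suc that by auto
    then show ?case by (auto intro!: DERIV_imp_deriv)
  qed (use D in auto)
  have "((deriv ^^ i) f has_real_derivative (deriv ^^ Suc i) f x) (at x)" if "i < n" "x \<in> S" for i x
  proof -
    have "(deriv ^^ Suc i) f x = D (Suc i) x" using eq[of "Suc i"] that by simp
    then show ?thesis
      using has_field_derivative_transform_within_open[OF D'[OF that] S that(2)] eq[of i] that by auto
  qed
  moreover have "continuous_on S ((deriv ^^ n) f)"
    using D(3) eq[of n] by (simp cong: continuous_on_cong)
  ultimately show "(\<forall>i<n. \<forall>x\<in>S. ((deriv ^^ i) f has_real_derivative (deriv ^^ Suc i) f x) (at x)) \<and>
    continuous_on S ((deriv ^^ n) f)" by blast
qed (unfold Cn_on_def, intro exI[of _ "\<lambda>i. (deriv ^^ i) f"], auto intro: has_field_derivative_at_within)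

lemma Cn_on_local:
  assumes "\<And>x. x \<in> S \<Longrightarrow> \<exists>T. open T \<and> x \<in> T \<and> T \<subseteq> S \<and> Cn_on n T f"
  shows "Cn_on n S f"
proof -
  have S: "open S"
    by (subst open_subopen) (use assms in blast)
  have "((deriv ^^ i) f has_real_derivative (deriv ^^ Suc i) f x) (at x)" if ix: "i < n" "x \<in> S" for i x
  proof -
    obtain T where "open T" "x \<in> T" "Cn_on n T f" using assms[OF ix(2)] by blast
    then show ?thesis using Cn_on_iff_deriv[of T n f] ix(1) by blast
  qed
  moreover have "isCont ((deriv ^^ n) f) x" if x: "x \<in> S" for x
  proof -
    obtain T where "open T" "x \<in> T" "Cn_on n T f" using assms[OF x] by blast
    then show ?thesis using Cn_on_iff_deriv[of T n f] continuous_on_eq_continuous_at by blast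
  qed
  ultimately show ?thesis
    unfolding Cn_on_iff_deriv[OF S] by (simp add: continuous_at_imp_continuous_on)
qed

text \<open>Bootstrapping: the derivative of \<open>inv h\<close> is the reciprocal of
  \<open>h'\<close> composed with \<open>inv h\<close>, so each order of smoothness of
  \<open>inv h\<close>, up to that of \<open>h'\<close>, yields the next one.\<close>

lemma Cn_on_inv:
  assumes "bij h" "continuous_on UNIV (inv h)" "\<And>x. deriv h x \<noteq> 0" "Cn_on n UNIV h" "n \<ge> 1"
  shows "Cn_on n UNIV (inv h)"
proof -
  obtain m where n: "n = Suc m" using assms(5) by (cases n) auto
  obtain h' where h': "\<forall>x. (h has_real_derivative h' x) (at x)" "Cn_on m UNIV h'"
    using assms(4) Cn_on_Suc[of UNIV] n by auto
  have nz: "h' x \<noteq> 0" for x using assms(3)[of x] h'(1) DERIV_imp_deriv by metis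
  have der: "(inv h has_real_derivative inverse (h' (inv h x))) (at x)" for x
  proof (rule DERIV_inverse_function[where f = h and a = "x - 1" and b = "x + 1"])
    show "isCont (inv h) x" using assms(2) continuous_on_eq_continuous_at by blast
  qed (use h' nz assms(1) in \<open>auto simp: bij_is_surj surj_f_inv_f\<close>)
  \<comment> \<open>The induction starts at order one, hence \<open>Suc j\<close>; since
    \<open>h'\<close> is only known to be C^m, \<open>j\<close> is bounded by
    \<open>m\<close>.\<close>
  have "j \<le> m \<Longrightarrow> Cn_on (Suc j) UNIV (inv h)" for j
  proof (induction j)
    case 0
    have "continuous_on UNIV h'" using h'(2) Cn_on_mono[of m UNIV h' 0] by (simp add: Cn_on_0)
    then have "continuous_on UNIV (\<lambda>x. inverse (h' (inv h x)))"
      using nz assms(2) by (auto intro!: continuous_on_inverse intro: continuous_on_compose2)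
    then show ?case using der
      by (subst Cn_on_Suc) (auto simp: Cn_on_0 intro!: exI[where x = "\<lambda>x. inverse (h' (inv h x))"])
  next
    case (Suc j)
    then have "Cn_on (Suc j) UNIV (\<lambda>x. h' (inv h x))"
      using Cn_on_mono[OF h'(2) Suc.prems] Suc by (intro Cn_on_compose[where T = UNIV and f = "inv h" and g = h']) auto
    then have "Cn_on (Suc j) UNIV (\<lambda>x. inverse (h' (inv h x)))"
      using nz by (intro Cn_on_inverse) auto
    then show ?case using der
      by (subst Cn_on_Suc) (auto intro!: exI[where x = "\<lambda>x. inverse (h' (inv h x))"])
  qed
  then show ?thesis using n by simp
qed

section \<open>One-sided derivatives at 0 and gluing\<close>

lemma isCont_eq_at_left:
  fixes f g :: "real \<Rightarrow> real"
  assumes "isCont f 0" "isCont g 0" "\<And>x. x < 0 \<Longrightarrow> f x = g x"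
  shows "f 0 = g 0"
proof -
  have "(f \<longlongrightarrow> f 0) (at_left 0)" "(g \<longlongrightarrow> g 0) (at_left 0)"
    using assms(1,2) isCont_def tendsto_within_subset[of _ _ _ UNIV] by blast+
  moreover have "\<forall>\<^sub>F x in at_left (0::real). f x = g x"
    using assms(3) by (auto simp: eventually_at_filter)
  ultimately show ?thesis
    using tendsto_cong tendsto_unique trivial_limit_at_left_real by blast
qed

lemma isCont_deriv_funpow:
  assumes "Cn_on n UNIV f" "i \<le> n"
  shows "isCont ((deriv ^^ i) f) x"
  using Cn_on_mono[OF assms] Cn_on_iff_deriv[of UNIV i f] continuous_on_eq_continuous_at by blast

text \<open>Equality passes to all derivatives on the open half-line, and continuity of those of
  order at most \<open>n\<close> carries it to the endpoint 0.\<close>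

lemma deriv_funpow_eq_left:
  assumes "Cn_on n UNIV f" "Cn_on n UNIV g" "\<And>x. x < 0 \<Longrightarrow> f x = g x" "i \<le> n"
  shows "(deriv ^^ i) f 0 = (deriv ^^ i) g 0"
  using isCont_eq_at_left[of "(deriv ^^ i) f" "(deriv ^^ i) g"] isCont_deriv_funpow assms
    deriv_funpow_cong_open[of "{..<0}" f g] by auto

lemma deriv_funpow_scale:
  assumes "Cn_on n UNIV h" "i \<le> n"
  shows "(deriv ^^ i) (\<lambda>x. b * h (c * x)) x = b * c ^ i * (deriv ^^ i) h (c * x)"
  using assms(2)
proof (induction i arbitrary: x)
  case (Suc i)
  then have "(deriv ^^ i) (\<lambda>x. b * h (c * x)) = (\<lambda>x. b * c ^ i * (deriv ^^ i) h (c * x))" by auto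
  moreover have "((deriv ^^ i) h has_real_derivative (deriv ^^ Suc i) h y) (at y)" for y
    using Suc.prems assms(1) Cn_on_iff_deriv[of UNIV n h] by auto
  then have "((\<lambda>x. b * c ^ i * (deriv ^^ i) h (c * x)) has_real_derivative
      b * c ^ i * ((deriv ^^ Suc i) h (c * x) * c)) (at x)"
    by (intro DERIV_cmult DERIV_chain2[where g = "(*) c"]) (auto intro!: derivative_eq_intros)
  ultimately show ?case by (simp add: DERIV_imp_deriv algebra_simps)
qed simp

lemma Cn_on_scale: "Cn_on n UNIV h \<Longrightarrow> Cn_on n UNIV (\<lambda>x. b * h (c * x))"
  by (intro Cn_on_mult Cn_on_const Cn_on_compose[where T = UNIV and f = "(*) c" and g = h] Cn_on_id) auto

text \<open>Reflection in 0 reduces this to the left half-line; the sign (-1)^i appears on both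
  sides and cancels.\<close>

lemma deriv_funpow_eq_right:
  assumes "Cn_on n UNIV f" "Cn_on n UNIV g" "\<And>x. x > 0 \<Longrightarrow> f x = g x" "i \<le> n"
  shows "(deriv ^^ i) f 0 = (deriv ^^ i) g 0"
proof -
  have "(deriv ^^ i) (\<lambda>x. 1 * f ((-1) * x)) 0 = (deriv ^^ i) (\<lambda>x. 1 * g ((-1) * x)) 0"
    by (rule deriv_funpow_eq_left[OF Cn_on_scale Cn_on_scale]) (use assms in auto)
  then show ?thesis
    using deriv_funpow_scale[of n f i 1 "-1" 0] deriv_funpow_scale[of n g i 1 "-1" 0] assms by simp
qed

lemma DERIV_glue:
  fixes u v :: "real \<Rightarrow> real"
  assumes "(u has_real_derivative d) (at 0)" "(v has_real_derivative d) (at 0)" "u 0 = v 0"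
  shows "((\<lambda>x. if x \<le> 0 then u x else v x) has_real_derivative d) (at 0)"
proof -
  have "((\<lambda>x. if x \<le> 0 then u x else v x) has_real_derivative d) (at 0 within {..0} \<union> {0..})"
    unfolding has_field_derivative_iff Lim_within_Un
  proof (intro conjI)
    have "((\<lambda>y. (u y - u 0) / (y - 0)) \<longlongrightarrow> d) (at 0 within {..0})"
      using assms(1) has_field_derivative_at_within has_field_derivative_iff by blast
    then show "((\<lambda>y. ((if y \<le> 0 then u y else v y) - (if (0::real) \<le> 0 then u 0 else v 0)) / (y - 0))
        \<longlongrightarrow> d) (at 0 within {..0})"
      by (rule Lim_transform_eventually) (auto simp: eventually_at_filter)
    have "((\<lambda>y. (v y - v 0) / (y - 0)) \<longlongrightarrow> d) (at 0 within {0..})"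
      using assms(2) has_field_derivative_at_within has_field_derivative_iff by blast
    then show "((\<lambda>y. ((if y \<le> 0 then u y else v y) - (if (0::real) \<le> 0 then u 0 else v 0)) / (y - 0))
        \<longlongrightarrow> d) (at 0 within {0..})"
      by (rule Lim_transform_eventually) (use assms(3) in \<open>auto simp: eventually_at_filter\<close>)
  qed
  moreover have "{..0} \<union> {0..} = (UNIV :: real set)" by auto
  ultimately show ?thesis by simp
qed

text \<open>The glued tower switches at 0 from the derivatives of \<open>u\<close> to those of
  \<open>v\<close>. Agreement at 0 makes each level differentiable with the next level as
  derivative, and the last level continuous.\<close>

lemma Cn_on_glue:
  assumes u: "Cn_on n UNIV u" and v: "Cn_on n UNIV v"
    and eq: "\<And>i. i \<le> n \<Longrightarrow> (deriv ^^ i) u 0 = (deriv ^^ i) v 0"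
  shows "Cn_on n UNIV (\<lambda>x. if x \<le> 0 then u x else v x)"
  unfolding Cn_on_def
proof (intro exI[of _ "\<lambda>i x. if x \<le> 0 then (deriv ^^ i) u x else (deriv ^^ i) v x"] conjI ballI allI impI)
  fix i and x :: real assume "i < n"
  have du: "((deriv ^^ i) u has_real_derivative (deriv ^^ Suc i) u y) (at y)"
    and dv: "((deriv ^^ i) v has_real_derivative (deriv ^^ Suc i) v y) (at y)" for y
    using \<open>i < n\<close> u v Cn_on_iff_deriv[of UNIV n] by auto
  consider "x < 0" | "x = 0" | "x > 0" by linarith
  then show "((\<lambda>x. if x \<le> 0 then (deriv ^^ i) u x else (deriv ^^ i) v x) has_real_derivative
      (if x \<le> 0 then (deriv ^^ Suc i) u x else (deriv ^^ Suc i) v x)) (at x)"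
  proof cases
    case 1
    show ?thesis
      using has_field_derivative_transform_within_open[OF du, of "{..<0}" x] 1 by auto
  next
    case 2
    show ?thesis
      using DERIV_glue[OF du[of 0]] dv[of 0] eq[of i] eq[of "Suc i"] \<open>i < n\<close> 2
      by (auto simp del: funpow.simps)
  next
    case 3
    show ?thesis
      using has_field_derivative_transform_within_open[OF dv, of "{0<..}" x] 3 by auto
  qed
next
  have "continuous_on ({..0} \<union> {0..}) (\<lambda>x. if x \<le> 0 then (deriv ^^ n) u x else (deriv ^^ n) v x)"
    by (rule continuous_on_If)
       (use eq[of n] isCont_deriv_funpow u v in \<open>auto intro!: continuous_at_imp_continuous_on\<close>)
  moreover have "{..0} \<union> {0..} = (UNIV :: real set)" by auto
  ultimately show "continuous_on UNIV (\<lambda>x. if x \<le> 0 then (deriv ^^ n) u x else (deriv ^^ n) v x)" by simp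
qed auto

lemma Ck_on_cong: "(\<And>x. x \<in> S \<Longrightarrow> f x = g x) \<Longrightarrow> Ck_on k S f \<longleftrightarrow> Ck_on k S g"
  unfolding Ck_on_def using Cn_on_cong by metis

lemma Ck_on_subset: "Ck_on k S f \<Longrightarrow> T \<subseteq> S \<Longrightarrow> Ck_on k T f"
  unfolding Ck_on_def using Cn_on_subset by metis

lemma Ck_on_compose:
  "\<lbrakk>open S; open T; f ` S \<subseteq> T; Ck_on k S f; Ck_on k T g\<rbrakk> \<Longrightarrow> Ck_on k S (g \<circ> f)"
  unfolding Ck_on_def comp_def using Cn_on_compose by metis

lemma Ck_on_local:
  assumes "\<And>x. x \<in> S \<Longrightarrow> \<exists>T. open T \<and> x \<in> T \<and> T \<subseteq> S \<and> Ck_on k T f"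
  shows "Ck_on k S f"
  unfolding Ck_on_def
proof (intro allI impI Cn_on_local)
  fix n x assume "enat n \<le> k" "x \<in> S"
  then show "\<exists>T. open T \<and> x \<in> T \<and> T \<subseteq> S \<and> Cn_on n T f"
    using assms unfolding Ck_on_def by blast
qed

lemma Ck_on_scale: "open S \<Longrightarrow> Ck_on k S (\<lambda>x. c * x)"
  unfolding Ck_on_def by (auto intro!: Cn_on_mult Cn_on_const Cn_on_id)

lemma Ck_on_imp_continuous: "Ck_on k S f \<Longrightarrow> continuous_on S f"
  by (auto simp: Ck_on_def Cn_on_0 zero_enat_def[symmetric] dest: spec[of _ 0])

section \<open>Homeomorphisms of the line with two origins\<close>

text \<open>The inverse of the chart \<open>real_of_L\<close> on \<open>LV\<close>, as
  \<open>Pt\<close> is on \<open>LU\<close>. Chart computations become computations with these two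
  sections, which agree off 0.\<close>

definition Pt2 :: "real \<Rightarrow> L" where
  "Pt2 x = (if x = 0 then Org2 else Pt x)"

lemma real_of_L_Pt2 [simp]: "real_of_L (Pt2 x) = x"
  by (simp add: Pt2_def)

lemma Pt2_eq_Pt [simp]: "x \<noteq> 0 \<Longrightarrow> Pt2 x = Pt x"
  by (simp add: Pt2_def)

lemma mem_LU_LV [simp]:
  "Pt x \<in> LU" "Pt2 x \<in> LU \<longleftrightarrow> x \<noteq> 0" "Pt x \<in> LV \<longleftrightarrow> x \<noteq> 0" "Pt2 x \<in> LV"
  by (auto simp: LU_def LV_def Pt2_def)

text \<open>Makes the two origins symmetric: the topology is the final one for \<open>Pt\<close> and
  \<open>Pt2\<close>, so openness and continuity are tested on two copies of the real line.\<close>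

lemma Lopen_iff: "Lopen S \<longleftrightarrow> open (Pt -` S) \<and> open (Pt2 -` S)"
proof -
  have "Pt2 -` S = (if Org2 \<in> S then insert 0 (Pt -` S) else Pt -` S - {0})"
    by (auto simp: Pt2_def split: if_splits)
  then show ?thesis by (auto simp: Lopen_def open_Diff)
qed

lemma openin_Ltop: "openin Ltop S \<longleftrightarrow> Lopen S"
  unfolding Ltop_def by (simp add: topology_inverse'[OF istopology_Lopen])

lemma topspace_Ltop [simp]: "topspace Ltop = UNIV"
proof -
  have "openin Ltop UNIV" by (simp add: openin_Ltop Lopen_iff)
  then show ?thesis using openin_subset by blast
qed

lemma Lopen_LU: "Lopen LU" and Lopen_LV: "Lopen LV"
proof -
  have "Pt -` LU = UNIV" "Pt2 -` LU = - {0}" "Pt -` LV = - {0}" "Pt2 -` LV = UNIV" by auto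
  then show "Lopen LU" "Lopen LV" by (simp_all add: Lopen_iff open_Compl)
qed

lemma Lopen_Int: "Lopen S \<Longrightarrow> Lopen T \<Longrightarrow> Lopen (S \<inter> T)"
  by (simp add: Lopen_iff open_Int)

lemma continuous_map_Ltop:
  "continuous_map Ltop X f \<longleftrightarrow> f \<in> UNIV \<rightarrow> topspace X \<and> (\<forall>S. openin X S \<longrightarrow> Lopen (f -` S))"
  by (auto simp: continuous_map_def openin_Ltop vimage_def)

lemma continuous_map_real_of_L: "continuous_map Ltop euclideanreal real_of_L"
  by (auto simp: continuous_map_Ltop Lopen_iff vimage_def)

lemma continuous_map_Pt: "continuous_map euclideanreal Ltop Pt"
  and continuous_map_Pt2: "continuous_map euclideanreal Ltop Pt2"
  by (auto simp: continuous_map_def openin_Ltop Lopen_iff vimage_def)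

text \<open>What homeomorphisms of \<open>L\<close> induce on the real line once the two origins are
  identified.\<close>

definition homeo0 :: "(real \<Rightarrow> real) set" where
  "homeo0 = {h. bij h \<and> h 0 = 0 \<and> continuous_on UNIV h \<and> continuous_on UNIV (inv h)}"

lemma homeo0_eq_0_iff: "h \<in> homeo0 \<Longrightarrow> h x = 0 \<longleftrightarrow> x = 0"
  using inj_eq[of h x 0] by (auto simp: homeo0_def bij_def)

lemma homeo0_inv: "h \<in> homeo0 \<Longrightarrow> inv h \<in> homeo0"
  unfolding homeo0_def by (auto simp: bij_imp_bij_inv inv_inv_eq inv_f_eq bij_is_inj)

lemma homeo0_comp: "g \<in> homeo0 \<Longrightarrow> h \<in> homeo0 \<Longrightarrow> g \<circ> h \<in> homeo0"
  unfolding homeo0_def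
  by (auto simp: bij_comp o_inv_distrib intro: continuous_on_compose2[of UNIV])

lemma homeo0_comp_inv [simp]: "h \<in> homeo0 \<Longrightarrow> h \<circ> inv h = id" "h \<in> homeo0 \<Longrightarrow> inv h \<circ> h = id"
  unfolding homeo0_def bij_def by (auto simp: surj_iff[symmetric])

lemma homeo0_monotone:
  assumes "h \<in> homeo0"
  shows "strict_mono h \<or> strict_antimono_on UNIV h"
proof -
  have "(\<forall>x\<in>UNIV. \<forall>y\<in>UNIV. x < y \<longrightarrow> h x < h y) \<or> (\<forall>x\<in>UNIV. \<forall>y\<in>UNIV. x < y \<longrightarrow> h y < h x)"
    using assms injective_eq_monotone_map[of UNIV h]
    unfolding homeo0_def bij_def strict_mono_on_def monotone_on_def by auto
  then show ?thesis by (auto simp: strict_mono_def monotone_on_def)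
qed

text \<open>\<open>s\<close> tells whether the origins are fixed. Using \<open>Pt2\<close> in place
  of \<open>Pt\<close> changes the image only where \<open>h\<close> vanishes, which for
  \<open>h \<in> homeo0\<close> is at 0 alone.\<close>

definition lift :: "bool \<Rightarrow> (real \<Rightarrow> real) \<Rightarrow> L \<Rightarrow> L" where
  "lift s h p = (case p of Pt x \<Rightarrow> (if s then Pt else Pt2) (h x) | Org2 \<Rightarrow> (if s then Org2 else Pt 0))"

lemma lift_Pt [simp]: "lift s h (Pt x) = (if s then Pt else Pt2) (h x)"
  by (simp add: lift_def)

lemma lift_Org2 [simp]: "lift s h Org2 = (if s then Org2 else Pt 0)"
  by (simp add: lift_def)

lemma lift_Pt2 [simp]: "h \<in> homeo0 \<Longrightarrow> lift s h (Pt2 x) = (if s then Pt2 else Pt) (h x)"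
  using homeo0_eq_0_iff[of h x] by (auto simp: lift_def Pt2_def homeo0_def)

text \<open>\<open>s = t\<close> is multiplication of signs: the composite fixes the origins iff
  both factors fix or both exchange them. The same encoding serves later for orientations.\<close>

lemma lift_comp: "g \<in> homeo0 \<Longrightarrow> lift s g \<circ> lift t h = lift (s = t) (g \<circ> h)"
proof
  fix p assume g: "g \<in> homeo0"
  then have "g 0 = 0" by (simp add: homeo0_def)
  then show "(lift s g \<circ> lift t h) p = lift (s = t) (g \<circ> h) p"
    by (cases p) (auto simp: Pt2_def homeo0_eq_0_iff[OF g])
qed

lemma lift_id [simp]: "lift True id = id"
  by (rule ext, case_tac x) auto

lemma lift_eq_iff [simp]: "h 0 = 0 \<Longrightarrow> g 0 = 0 \<Longrightarrow> lift s h = lift t g \<longleftrightarrow> s = t \<and> h = g"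
proof
  assume eq: "lift s h = lift t g"
  have "h x = g x" for x
    using arg_cong[OF fun_cong[OF eq, of "Pt x"], of real_of_L] by (auto split: if_splits)
  moreover have "s = t" using fun_cong[OF eq, of Org2] by (auto split: if_splits)
  ultimately show "s = t \<and> h = g" by auto
qed auto

lemma inv_lift:
  assumes "h \<in> homeo0"
  shows "inv (lift s h) = lift s (inv h)"
  using assms by (intro inv_unique_comp) (auto simp: lift_comp homeo0_inv)

lemma continuous_map_lift:
  assumes "h \<in> homeo0"
  shows "continuous_map Ltop Ltop (lift s h)"
proof -
  have "open (h -` W)" if "open W" for W
    using assms that by (auto simp: homeo0_def continuous_on_open_vimage)
  moreover have "Pt -` lift s h -` S = h -` (if s then Pt else Pt2) -` S"
    "Pt2 -` lift s h -` S = h -` (if s then Pt2 else Pt) -` S" for S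
    using assms by auto
  ultimately show ?thesis by (auto simp: continuous_map_Ltop openin_Ltop Lopen_iff)
qed

text \<open>A continuous map into \<open>\<real>\<close> takes equal values at the two origins, as these cannot be separated;
  an injective continuous self-map of \<open>L\<close> therefore permutes them.\<close>

lemma continuous_injective_L_eq_lift:
  assumes f: "continuous_map Ltop Ltop f" and "inj f"
  defines "h \<equiv> real_of_L \<circ> f \<circ> Pt"
  shows "continuous_on UNIV h" "\<And>x. h x = 0 \<longleftrightarrow> x = 0" "\<exists>s. f = lift s h"
proof -
  have "continuous_map euclideanreal euclideanreal h"
    unfolding h_def by (intro continuous_map_compose[OF continuous_map_Pt]
        continuous_map_compose[OF f] continuous_map_real_of_L)
  then show h: "continuous_on UNIV h" by simp
  have "continuous_map euclideanreal euclideanreal (real_of_L \<circ> f \<circ> Pt2)"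
    by (intro continuous_map_compose[OF continuous_map_Pt2]
        continuous_map_compose[OF f] continuous_map_real_of_L)
  then have "isCont (real_of_L \<circ> f \<circ> Pt2) 0"
    by (simp add: continuous_on_eq_continuous_at comp_def)
  moreover have "isCont h 0" using h by (simp add: continuous_on_eq_continuous_at)
  ultimately have "h 0 = (real_of_L \<circ> f \<circ> Pt2) 0"
    using isCont_eq_at_left[of h "real_of_L \<circ> f \<circ> Pt2"] by (simp add: h_def)
  then have eq: "real_of_L (f (Pt 0)) = real_of_L (f Org2)" by (simp add: h_def Pt2_def)
  have neq: "f p \<noteq> f q" if "p \<noteq> q" for p q using that \<open>inj f\<close> by (simp add: inj_eq)
  \<comment> \<open>Distinct points with the same image under \<open>real_of_L\<close> can only be
    the two origins.\<close>
  have org: "f (Pt 0) = Pt 0 \<and> f Org2 = Org2 \<or> f (Pt 0) = Org2 \<and> f Org2 = Pt 0"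
    using eq neq[of "Pt 0" Org2] by (cases "f (Pt 0)"; cases "f Org2") auto
  \<comment> \<open>Both origins are already taken as values, so by injectivity no other point is
    sent to one of them.\<close>
  have nz: "f (Pt x) = Pt (h x) \<and> h x \<noteq> 0" if "x \<noteq> 0" for x
    using neq[of "Pt x" "Pt 0"] neq[of "Pt x" Org2] org that by (cases "f (Pt x)") (auto simp: h_def)
  have h0: "h 0 = 0" using org by (auto simp: h_def)
  show "h x = 0 \<longleftrightarrow> x = 0" for x using nz h0 by blast
  have "f = lift (f (Pt 0) = Pt 0) h"
  proof
    fix p show "f p = lift (f (Pt 0) = Pt 0) h p"
    proof (cases p)
      case (Pt x)
      then show ?thesis using org nz[of x] h0 by (cases "x = 0") (auto simp: Pt2_def)
    qed (use org in auto)
  qed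
  then show "\<exists>s. f = lift s h" by blast
qed

text \<open>Apply the preceding description to the map and to its inverse. The two induced maps of
  the line are mutually inverse: off 0 by evaluating the composites at \<open>Pt x\<close>, at 0
  because both vanish there.\<close>

lemma homeomorphic_map_L_iff:
  "homeomorphic_map Ltop Ltop f \<longleftrightarrow> (\<exists>s. \<exists>h\<in>homeo0. f = lift s h)"
proof
  assume "homeomorphic_map Ltop Ltop f"
  then obtain g where fg: "homeomorphic_maps Ltop Ltop f g"
    using homeomorphic_map_maps by blast
  then have *: "continuous_map Ltop Ltop f" "continuous_map Ltop Ltop g" "\<And>p. g (f p) = p" "\<And>p. f (g p) = p"
    by (auto simp: homeomorphic_maps_def)
  then have inj: "inj f" "inj g" by (metis injI)+
  obtain s t where st: "f = lift s (real_of_L \<circ> f \<circ> Pt)" "g = lift t (real_of_L \<circ> g \<circ> Pt)"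
    using continuous_injective_L_eq_lift(3) * inj by metis
  define h k where "h = real_of_L \<circ> f \<circ> Pt" and "k = real_of_L \<circ> g \<circ> Pt"
  have h: "continuous_on UNIV h" "\<And>x. h x = 0 \<longleftrightarrow> x = 0" and k: "continuous_on UNIV k" "\<And>x. k x = 0 \<longleftrightarrow> x = 0"
    unfolding h_def k_def using continuous_injective_L_eq_lift(1,2) * inj by blast+
  have fh: "f = lift s h" and gk: "g = lift t k" using st by (simp_all add: h_def k_def)
  have "h (k x) = x" for x
  proof (cases "x = 0")
    case False
    then show ?thesis
      using *(4)[of "Pt x"] h(2)[of "k x"] k(2)[of x] by (auto simp: fh gk split: if_splits)
  qed (use h(2)[of 0] k(2)[of 0] in auto)
  moreover have "k (h x) = x" for x
  proof (cases "x = 0")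
    case False
    then show ?thesis
      using *(3)[of "Pt x"] k(2)[of "h x"] h(2)[of x] by (auto simp: fh gk split: if_splits)
  qed (use h(2)[of 0] k(2)[of 0] in auto)
  ultimately have "bij h" "inv h = k"
    by (auto intro!: o_bij[of k] inv_unique_comp)
  then have "h \<in> homeo0" using h k by (simp add: homeo0_def)
  then show "\<exists>s. \<exists>h\<in>homeo0. f = lift s h" using fh by blast
next
  assume "\<exists>s. \<exists>h\<in>homeo0. f = lift s h"
  then obtain s h where h: "h \<in> homeo0" "f = lift s h" by blast
  have "homeomorphic_maps Ltop Ltop (lift s h) (lift s (inv h))"
    unfolding homeomorphic_maps_def
    using h fun_cong[OF lift_comp[of h s s "inv h"]] fun_cong[OF lift_comp[of "inv h" s s h]]
    by (auto intro: continuous_map_lift homeo0_inv)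
  then show "homeomorphic_map Ltop Ltop f" using h homeomorphic_map_maps by blast
qed

text \<open>Orientation is tested only off 0. As \<open>h\<close> is monotone on the whole line,
  comparing its values at 1 and 2 tells the two cases apart.\<close>

lemma orient_pres_lift: "h \<in> homeo0 \<Longrightarrow> orient_pres (lift s h) \<longleftrightarrow> strict_mono h"
  and orient_rev_lift: "h \<in> homeo0 \<Longrightarrow> orient_rev (lift s h) \<longleftrightarrow> strict_antimono_on UNIV h"
proof -
  assume h: "h \<in> homeo0"
  have eq: "(\<lambda>x. real_of_L (lift s h (Pt x))) = h" by auto
  have "\<not> strict_mono_on (- {0}) h" if "strict_antimono_on UNIV h"
    using that monotone_onD[of "- {0}" "(<)" "(<)" h 1 2] monotone_onD[of UNIV "(<)" "(>)" h 1 2] by auto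
  moreover have "\<not> strict_antimono_on (- {0}) h" if "strict_mono h"
    using that monotone_onD[of "- {0}" "(<)" "(>)" h 1 2] monotone_onD[of UNIV "(<)" "(<)" h 1 2] by auto
  moreover have "strict_mono_on (- {0}) h" if "strict_mono h"
    using that by (auto simp: monotone_on_def)
  moreover have "strict_antimono_on (- {0}) h" if "strict_antimono_on UNIV h"
    using that by (auto simp: monotone_on_def)
  ultimately show "orient_pres (lift s h) \<longleftrightarrow> strict_mono h"
    "orient_rev (lift s h) \<longleftrightarrow> strict_antimono_on UNIV h"
    unfolding orient_pres_def orient_rev_def eq using homeo0_monotone[OF h] by blast+
qed

lemma fixes_origins_lift: "h \<in> homeo0 \<Longrightarrow> fixes_origins (lift s h) \<longleftrightarrow> s"
  and exchanges_origins_lift: "h \<in> homeo0 \<Longrightarrow> exchanges_origins (lift s h) \<longleftrightarrow> \<not> s"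
  by (simp_all add: fixes_origins_def exchanges_origins_def homeo0_def Pt2_def)

section \<open>Diffeomorphisms in charts\<close>

lemma chart_open_image:
  assumes "is_chart (U, \<phi>)" "Lopen W"
  shows "open (\<phi> ` (U \<inter> W))"
proof -
  have U: "Lopen U" "open (\<phi> ` U)"
    and hom: "homeomorphic_map (subtopology Ltop U) (subtopology euclideanreal (\<phi> ` U)) \<phi>"
    using assms(1) by (auto simp: is_chart_def)
  have "openin (subtopology Ltop U) (U \<inter> W)"
    using assms(2) openin_Ltop openin_subtopology_Int2 by blast
  then have "openin (subtopology euclideanreal (\<phi> ` U)) (\<phi> ` (U \<inter> W))"
    using homeomorphic_imp_open_map[OF hom] by (simp add: open_map_def)
  then show ?thesis using U(2) by (simp add: openin_open_eq)
qed

lemma chart_inj_on: "is_chart (U, \<phi>) \<Longrightarrow> inj_on \<phi> U"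
  by (auto simp: is_chart_def dest: homeomorphic_imp_injective_map)

text \<open>Serves charts onto the whole line, such as both charts of the special atlas of
  \<open>w a\<close>: the continuous section \<open>r\<close> provides the inverse
  homeomorphism.\<close>

lemma is_chartI:
  assumes "Lopen U" "continuous_map Ltop euclideanreal q" "continuous_map euclideanreal Ltop r"
    and r: "\<And>x. r x \<in> U" "\<And>x. q (r x) = x" "\<And>p. p \<in> U \<Longrightarrow> r (q p) = p"
  shows "is_chart (U, q)"
proof -
  have "q ` U = UNIV" using r by (metis UNIV_eq_I image_eqI)
  moreover have "homeomorphic_maps (subtopology Ltop U) euclideanreal q r"
    unfolding homeomorphic_maps_def using assms
    by (auto simp: continuous_map_in_subtopology intro: continuous_map_from_subtopology)
  ultimately show ?thesis
    using assms(1) homeomorphic_map_maps[of "subtopology Ltop U" euclideanreal q]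
    by (auto simp: is_chart_def)
qed

text \<open>Near each point an expression in arbitrary charts factors as a transition map into
  \<open>A\<close>, an expression in charts of \<open>A\<close> and \<open>B\<close>, and a
  transition map out of \<open>B\<close>. Compatibility within the enlarged atlases makes the outer
  factors C^k.\<close>

lemma Ck_map_iff_atlas:
  assumes A: "Ck_atlas k A" and B: "Ck_atlas k B" and f: "continuous_map Ltop Ltop f"
  shows "Ck_map k (Ck_struct_of k A) (Ck_struct_of k B) f \<longleftrightarrow>
    (\<forall>(U, \<phi>)\<in>A. \<forall>(V, \<psi>)\<in>B. Ck_on k (\<phi> ` (U \<inter> f -` V)) (\<psi> \<circ> f \<circ> inv_into U \<phi>))"
proof
  have "A \<in> Ck_struct_of k A" "B \<in> Ck_struct_of k B"
    using A B by (simp_all add: Ck_struct_of_def)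
  then have "A \<subseteq> \<Union> (Ck_struct_of k A)" "B \<subseteq> \<Union> (Ck_struct_of k B)" by blast+
  then show "Ck_map k (Ck_struct_of k A) (Ck_struct_of k B) f \<Longrightarrow>
    (\<forall>(U, \<phi>)\<in>A. \<forall>(V, \<psi>)\<in>B. Ck_on k (\<phi> ` (U \<inter> f -` V)) (\<psi> \<circ> f \<circ> inv_into U \<phi>))"
    unfolding Ck_map_def by blast
next
  assume AB: "\<forall>(U, \<phi>)\<in>A. \<forall>(V, \<psi>)\<in>B. Ck_on k (\<phi> ` (U \<inter> f -` V)) (\<psi> \<circ> f \<circ> inv_into U \<phi>)"
  have "Ck_on k (\<phi> ` (U \<inter> f -` V)) (\<psi> \<circ> f \<circ> inv_into U \<phi>)"
    if "(U, \<phi>) \<in> A'" "A' \<in> Ck_struct_of k A" "(V, \<psi>) \<in> B'" "B' \<in> Ck_struct_of k B" for U \<phi> A' V \<psi> B'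
  proof (rule Ck_on_local)
    have AA': "Ck_atlas k (A \<union> A')" "Ck_atlas k (B \<union> B')" using that by (auto simp: Ck_struct_of_def)
    fix y assume "y \<in> \<phi> ` (U \<inter> f -` V)"
    then obtain p where p: "p \<in> U" "f p \<in> V" "y = \<phi> p" by auto
    obtain U0 \<phi>0 V0 \<psi>0 where 0: "(U0, \<phi>0) \<in> A" "p \<in> U0" "(V0, \<psi>0) \<in> B" "f p \<in> V0"
    proof -
      have "p \<in> \<Union> (fst ` A)" "f p \<in> \<Union> (fst ` B)" using A B by (simp_all add: Ck_atlas_def)
      then show ?thesis using that by auto
    qed
    have ch: "is_chart (U, \<phi>)" "is_chart (V, \<psi>)" "is_chart (U0, \<phi>0)" "is_chart (V0, \<psi>0)"
      using AA' that 0 by (auto simp: Ck_atlas_def)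
    have Lo: "Lopen U" "Lopen V" "Lopen U0" "Lopen V0" using ch by (auto simp: is_chart_def)
    have inj: "inj_on \<phi> U" "inj_on \<psi> V" "inj_on \<phi>0 U0" "inj_on \<psi>0 V0" using ch chart_inj_on by auto
    have pre: "Lopen (f -` W)" if "Lopen W" for W
      using f that by (auto simp: continuous_map_Ltop openin_Ltop)
    have c1: "Ck_on k (\<phi> ` (U \<inter> U0)) (\<phi>0 \<circ> inv_into U \<phi>)"
      and c2: "Ck_on k (\<psi>0 ` (V0 \<inter> V)) (\<psi> \<circ> inv_into V0 \<psi>0)"
      using AA' that 0 unfolding Ck_atlas_def Ck_compatible_def by blast+
    have c3: "Ck_on k (\<phi>0 ` (U0 \<inter> f -` V0)) (\<psi>0 \<circ> f \<circ> inv_into U0 \<phi>0)"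
      using AB 0 by auto
    \<comment> \<open>Restricting to points of \<open>U0\<close> whose image lies in both target
      charts makes all three factors defined.\<close>
    define W where "W = U0 \<inter> f -` (V \<inter> V0)"
    have W: "Lopen W" unfolding W_def by (intro Lopen_Int pre Lo)
    have o: "open (\<phi> ` (U \<inter> W))" "open (\<phi>0 ` (U0 \<inter> f -` V0))" "open (\<psi>0 ` (V0 \<inter> V))"
      using ch W pre Lo chart_open_image by auto
    have c1': "Ck_on k (\<phi> ` (U \<inter> W)) (\<phi>0 \<circ> inv_into U \<phi>)"
      using c1 by (rule Ck_on_subset) (auto simp: W_def)
    have c31: "Ck_on k (\<phi> ` (U \<inter> W)) ((\<psi>0 \<circ> f \<circ> inv_into U0 \<phi>0) \<circ> (\<phi>0 \<circ> inv_into U \<phi>))"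
      by (rule Ck_on_compose[OF o(1,2) _ c1' c3]) (auto simp: W_def inj inv_into_f_f)
    have "Ck_on k (\<phi> ` (U \<inter> W))
        ((\<psi> \<circ> inv_into V0 \<psi>0) \<circ> ((\<psi>0 \<circ> f \<circ> inv_into U0 \<phi>0) \<circ> (\<phi>0 \<circ> inv_into U \<phi>)))"
      by (rule Ck_on_compose[OF o(1,3) _ c31 c2]) (auto simp: W_def inj inv_into_f_f)
    moreover have "((\<psi> \<circ> inv_into V0 \<psi>0) \<circ> ((\<psi>0 \<circ> f \<circ> inv_into U0 \<phi>0) \<circ> (\<phi>0 \<circ> inv_into U \<phi>))) x
        = (\<psi> \<circ> f \<circ> inv_into U \<phi>) x" if "x \<in> \<phi> ` (U \<inter> W)" for x
      using that by (auto simp: W_def inj inv_into_f_f)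
    ultimately have "Ck_on k (\<phi> ` (U \<inter> W)) (\<psi> \<circ> f \<circ> inv_into U \<phi>)"
      by (subst (asm) Ck_on_cong) auto
    then show "\<exists>T. open T \<and> y \<in> T \<and> T \<subseteq> \<phi> ` (U \<inter> f -` V) \<and> Ck_on k T (\<psi> \<circ> f \<circ> inv_into U \<phi>)"
      using o(1) p 0 by (intro exI[of _ "\<phi> ` (U \<inter> W)"]) (auto simp: W_def)
  qed
  then show "Ck_map k (Ck_struct_of k A) (Ck_struct_of k B) f" unfolding Ck_map_def by blast
qed

section \<open>The structures \<open>S_a\<close>\<close>

lemma w_0 [simp]: "w a 0 = 0"
  by (simp add: w_def)

lemma w_1 [simp]: "w 1 = id"
  by (auto simp: w_def)

lemma w_inverse [simp]: "a > 0 \<Longrightarrow> w a (w (1 / a) x) = x" "a > 0 \<Longrightarrow> w (1 / a) (w a x) = x"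
  by (auto simp: w_def zero_less_mult_iff not_less zero_less_divide_iff divide_le_0_iff mult_le_0_iff)

lemma w_comp_inverse [simp]:
  "a > 0 \<Longrightarrow> w a \<circ> w (1 / a) = id" "a > 0 \<Longrightarrow> w (1 / a) \<circ> w a = id"
  by auto

lemma bij_w: "a > 0 \<Longrightarrow> bij (w a)"
  by (rule o_bij[of "w (1 / a)"]) auto

lemma inv_w: "a > 0 \<Longrightarrow> inv (w a) = w (1 / a)"
  by (rule inv_unique_comp) auto

lemma continuous_on_w: "continuous_on S (w a)"
proof -
  have "w a = (\<lambda>x. min x 0 + a * max x 0)" by (auto simp: w_def)
  then show ?thesis by (auto intro!: continuous_intros)
qed

lemma w_homeo0: "a > 0 \<Longrightarrow> w a \<in> homeo0"
  by (simp add: homeo0_def bij_w inv_w continuous_on_w)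

lemma w_mono: "a > 0 \<Longrightarrow> strict_mono (w a)"
  by (auto simp: strict_mono_def w_def intro: order.strict_trans1 mult_pos_pos)

lemma Ck_on_w: "Ck_on k (- {0}) (w a)"
proof (rule Ck_on_local)
  fix x :: real assume "x \<in> - {0}"
  then consider "x < 0" | "x > 0" by force
  then show "\<exists>T. open T \<and> x \<in> T \<and> T \<subseteq> - {0} \<and> Ck_on k T (w a)"
  proof cases
    case 1
    have "Ck_on k {..<0} (w a)"
      using Ck_on_scale[of "{..<0}" k 1] by (rule Ck_on_cong[THEN iffD1, rotated]) (auto simp: w_def)
    with 1 show ?thesis by (intro exI[of _ "{..<0}"]) auto
  next
    case 2
    have "Ck_on k {0<..} (w a)"
      using Ck_on_scale[of "{0<..}" k a] by (rule Ck_on_cong[THEN iffD1, rotated]) (auto simp: w_def)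
    with 2 show ?thesis by (intro exI[of _ "{0<..}"]) auto
  qed
qed

lemma Ck_on_w_comp:
  assumes "h \<in> homeo0" "Ck_on k (- {0}) h"
  shows "Ck_on k (- {0}) (w a \<circ> h)"
  by (rule Ck_on_compose[OF _ _ _ assms(2) Ck_on_w]) (auto simp: homeo0_eq_0_iff[OF assms(1)])

lemma Ck_on_comp_w:
  assumes "a > 0" "Ck_on k (- {0}) h"
  shows "Ck_on k (- {0}) (h \<circ> w a)"
  by (rule Ck_on_compose[OF _ _ _ Ck_on_w assms(2)]) (auto simp: homeo0_eq_0_iff[OF w_homeo0[OF assms(1)]])

text \<open>Trades the image and the \<open>inv_into\<close> of chart conditions for a preimage
  under an explicit section \<open>r\<close>, which simplification can compute.\<close>

lemma image_chart_eq_vimage: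
  assumes "\<And>x. r x \<in> U" "\<And>x. q (r x) = x" "\<And>p. p \<in> U \<Longrightarrow> r (q p) = p"
  shows "q ` (U \<inter> W) = r -` W" "inv_into U q = r"
proof -
  show "q ` (U \<inter> W) = r -` W"
    using assms by (auto simp: image_iff) (metis IntI)
  have "inj_on q U" using assms(3) by (metis inj_onI)
  then show "inv_into U q = r" using assms by (intro ext inv_into_f_eq) auto
qed

lemma Pt_chart: "real_of_L ` (LU \<inter> W) = Pt -` W" "inv_into LU real_of_L = Pt"
proof -
  have "Pt (real_of_L p) = p" if "p \<in> LU" for p using that by (auto simp: LU_def)
  then show "real_of_L ` (LU \<inter> W) = Pt -` W" "inv_into LU real_of_L = Pt"
    using image_chart_eq_vimage[of Pt LU real_of_L] by auto
qed

lemma Pt2_chart: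
  assumes "a > 0"
  shows "(w a \<circ> real_of_L) ` (LV \<inter> W) = (Pt2 \<circ> w (1 / a)) -` W"
    "inv_into LV (w a \<circ> real_of_L) = Pt2 \<circ> w (1 / a)"
proof -
  have "Pt2 (real_of_L p) = p" if "p \<in> LV" for p
    using that by (cases p) (auto simp: LV_def Pt2_def)
  then show "(w a \<circ> real_of_L) ` (LV \<inter> W) = (Pt2 \<circ> w (1 / a)) -` W"
    "inv_into LV (w a \<circ> real_of_L) = Pt2 \<circ> w (1 / a)"
    using image_chart_eq_vimage[of "Pt2 \<circ> w (1 / a)" LV "w a \<circ> real_of_L"] assms by auto
qed

text \<open>The two charts overlap in the complement of the origins, where the transition maps are
  \<open>w a\<close> and \<open>w (1 / a)\<close>; these fail to be smooth at most at 0.\<close>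

lemma Ck_atlas_special:
  assumes a: "a > 0"
  shows "Ck_atlas k (special_atlas (w a))"
proof -
  have "is_chart (LU, real_of_L)"
    by (rule is_chartI[OF Lopen_LU continuous_map_real_of_L continuous_map_Pt]) (auto simp: LU_def)
  moreover have "is_chart (LV, w a \<circ> real_of_L)"
  proof (rule is_chartI[OF Lopen_LV])
    show "continuous_map Ltop euclideanreal (w a \<circ> real_of_L)"
      by (rule continuous_map_compose[OF continuous_map_real_of_L]) (simp add: continuous_on_w)
    show "continuous_map euclideanreal Ltop (Pt2 \<circ> w (1 / a))"
      by (rule continuous_map_compose[OF _ continuous_map_Pt2]) (simp add: continuous_on_w)
    show "(Pt2 \<circ> w (1 / a)) ((w a \<circ> real_of_L) p) = p" if "p \<in> LV" for p
      using that a by (cases p) (auto simp: LV_def Pt2_def)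
  qed (use a in auto)
  moreover have "\<Union> (fst ` special_atlas (w a)) = UNIV"
    by (auto simp: special_atlas_def LU_def LV_def)
  moreover have "Ck_on k (- {0}) (w a)" "Ck_on k (- {0}) (w (1 / a))" by (rule Ck_on_w)+
  moreover have "Ck_on k UNIV (\<lambda>x. x)" using Ck_on_scale[of UNIV k 1] by simp
  moreover have "Pt -` LU = UNIV" "Pt -` LV = - {0}" "(Pt2 \<circ> w (1 / a)) -` LU = - {0}"
    "(Pt2 \<circ> w (1 / a)) -` LV = UNIV"
    using a by (auto simp: homeo0_eq_0_iff[OF w_homeo0[of "1 / a"]])
  moreover have "real_of_L \<circ> Pt = (\<lambda>x. x)" "(w a \<circ> real_of_L) \<circ> Pt = w a"
     "real_of_L \<circ> (Pt2 \<circ> w (1 / a)) = w (1 / a)"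
     "(w a \<circ> real_of_L) \<circ> (Pt2 \<circ> w (1 / a)) = (\<lambda>x. x)" using a by auto
  ultimately show ?thesis
    by (simp only: Ck_atlas_def Ck_compatible_def special_atlas_def ball_simps prod.case
        Pt_chart Pt2_chart[OF a] simp_thms)
qed

text \<open>Of the four pairs of charts, a pair gives a condition on the whole line exactly when
  \<open>lift s h\<close> sends the origin in the first chart to the origin in the second. The other
  two pairs only see the complement of 0.\<close>

lemma Ck_map_lift:
  assumes a: "a > 0" and b: "b > 0" and h: "h \<in> homeo0"
  shows "Ck_map k (S_a k a) (S_a k b) (lift s h) \<longleftrightarrow>
    (if s then Ck_on k UNIV h \<and> Ck_on k UNIV (w b \<circ> h \<circ> w (1 / a))
     else Ck_on k UNIV (w b \<circ> h) \<and> Ck_on k UNIV (h \<circ> w (1 / a)))"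
proof -
  note hz = homeo0_eq_0_iff[OF h]
  have wz: "w (1 / a) x = 0 \<longleftrightarrow> x = 0" for x
    using a by (simp add: homeo0_eq_0_iff[OF w_homeo0[of "1 / a"]])
  have "Pt -` lift s h -` LU = (if s then UNIV else - {0})"
    "Pt -` lift s h -` LV = (if s then - {0} else UNIV)"
    "(Pt2 \<circ> w (1 / a)) -` lift s h -` LU = (if s then - {0} else UNIV)"
    "(Pt2 \<circ> w (1 / a)) -` lift s h -` LV = (if s then UNIV else - {0})"
    using h by (auto simp: hz wz split: if_splits)
  moreover have "real_of_L \<circ> lift s h \<circ> Pt = h" "(w b \<circ> real_of_L) \<circ> lift s h \<circ> Pt = w b \<circ> h"
    "real_of_L \<circ> lift s h \<circ> (Pt2 \<circ> w (1 / a)) = h \<circ> w (1 / a)"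
    "(w b \<circ> real_of_L) \<circ> lift s h \<circ> (Pt2 \<circ> w (1 / a)) = w b \<circ> h \<circ> w (1 / a)"
    using h by auto
  ultimately have "Ck_map k (S_a k a) (S_a k b) (lift s h) \<longleftrightarrow>
     (Ck_on k (if s then UNIV else - {0}) h \<and> Ck_on k (if s then - {0} else UNIV) (w b \<circ> h)) \<and>
     (Ck_on k (if s then - {0} else UNIV) (h \<circ> w (1 / a)) \<and>
      Ck_on k (if s then UNIV else - {0}) (w b \<circ> h \<circ> w (1 / a)))"
    unfolding S_a_def
      Ck_map_iff_atlas[OF Ck_atlas_special[OF a] Ck_atlas_special[OF b] continuous_map_lift[OF h]]
    by (simp only: special_atlas_def Pt_chart Pt2_chart[OF a] ball_simps prod.case)
      (simp only: simp_thms)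
  moreover have "Ck_on k (- {0}) (w b \<circ> h)" "Ck_on k (- {0}) (h \<circ> w (1 / a))" if "Ck_on k UNIV h"
    using Ck_on_w_comp[OF h] Ck_on_comp_w[of "1 / a"] Ck_on_subset[OF that] a by auto
  \<comment> \<open>Off 0 the factor \<open>w b\<close> is undone by \<open>w (1 / b)\<close>, which
    is smooth there.\<close>
  moreover have "Ck_on k (- {0}) h" if "Ck_on k UNIV (w b \<circ> h)"
  proof -
    have "Ck_on k (- {0}) (w (1 / b) \<circ> (w b \<circ> h))"
      using b h by (intro Ck_on_w_comp homeo0_comp w_homeo0 Ck_on_subset[OF that]) auto
    then show ?thesis using b by (simp add: comp_def)
  qed
  moreover have "Ck_on k (- {0}) (w b \<circ> h \<circ> w (1 / a))" if "Ck_on k UNIV (h \<circ> w (1 / a))"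
    unfolding comp_assoc
    using a h by (intro Ck_on_w_comp homeo0_comp w_homeo0 Ck_on_subset[OF that]) auto
  ultimately show ?thesis by auto
qed

section \<open>Diffeomorphisms of the line fixing 0\<close>

lemma Dk_iff: "h \<in> Dk k \<longleftrightarrow> h \<in> homeo0 \<and> Ck_on k UNIV h \<and> Ck_on k UNIV (inv h)"
  unfolding Dk_def homeo0_def using Ck_on_imp_continuous by auto

lemma Dk_homeo0: "h \<in> Dk k \<Longrightarrow> h \<in> homeo0"
  by (simp add: Dk_iff)

lemma Dk_comp:
  assumes "g \<in> Dk k" "h \<in> Dk k"
  shows "g \<circ> h \<in> Dk k"
proof -
  have "inv (g \<circ> h) = inv h \<circ> inv g" using assms by (intro o_inv_distrib) (auto simp: Dk_def)
  then show ?thesis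
    using assms unfolding Dk_iff
    by (auto intro!: homeo0_comp Ck_on_compose[of UNIV UNIV] simp del: comp_apply)
qed

lemma Dk_inv: "h \<in> Dk k \<Longrightarrow> inv h \<in> Dk k"
  unfolding Dk_iff by (auto simp: homeo0_inv) (auto simp: homeo0_def inv_inv_eq)

lemma Dk_linear: "c \<noteq> 0 \<Longrightarrow> (\<lambda>x. c * x) \<in> Dk k"
proof -
  assume c: "c \<noteq> 0"
  have "bij ((*) c)" "inv ((*) c) = (*) (1 / c)"
    using c by (auto intro!: o_bij[of "(*) (1 / c)"] inv_unique_comp)
  then show ?thesis by (auto simp: Dk_def Ck_on_scale)
qed

lemma Dk_id: "id \<in> Dk k"
  using Dk_linear[of 1 k] by (simp add: id_def)

text \<open>Each of the two conditions is the requirement in the chart around one of the origins; in the remaining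
  pairs of charts smoothness away from \<open>0\<close> suffices, and it follows.\<close>

definition Hk :: "enat \<Rightarrow> bool \<Rightarrow> real \<Rightarrow> real \<Rightarrow> (real \<Rightarrow> real) set" where
  "Hk k s a b = {h. if s then h \<in> Dk k \<and> w b \<circ> h \<circ> w (1 / a) \<in> Dk k
                    else w b \<circ> h \<in> Dk k \<and> h \<circ> w (1 / a) \<in> Dk k}"

lemma Hk_homeo0:
  assumes "b > 0" "h \<in> Hk k s a b"
  shows "h \<in> homeo0"
proof (cases s)
  case False
  then have "w (1 / b) \<circ> (w b \<circ> h) \<in> homeo0"
    using assms by (intro homeo0_comp w_homeo0 Dk_homeo0[of _ k]) (auto simp: Hk_def)
  then show ?thesis using assms(1) by (simp add: comp_def)
qed (use assms in \<open>auto simp: Hk_def Dk_homeo0\<close>)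

lemma inv_conj_w:
  assumes "a > 0" "b > 0" "h \<in> homeo0"
  shows "inv (w b \<circ> h \<circ> w (1 / a)) = w a \<circ> inv h \<circ> w (1 / b)"
    "inv (w b \<circ> h) = inv h \<circ> w (1 / b)" "inv (h \<circ> w (1 / a)) = w a \<circ> inv h"
proof -
  have "bij h" "bij (w b)" "bij (w (1 / a))" "bij (h \<circ> w (1 / a))"
    using assms bij_w by (auto simp: homeo0_def bij_comp)
  then show "inv (w b \<circ> h \<circ> w (1 / a)) = w a \<circ> inv h \<circ> w (1 / b)"
    "inv (w b \<circ> h) = inv h \<circ> w (1 / b)" "inv (h \<circ> w (1 / a)) = w a \<circ> inv h"
    using assms by (simp_all add: o_inv_distrib inv_w comp_assoc)
qed

text \<open>The chart expressions of the inverse map are the inverses of the chart expressions, so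
  smoothness in both directions amounts to membership in \<open>Dk\<close>.\<close>

lemma lift_in_Diff_iff:
  assumes a: "a > 0" and b: "b > 0" and h: "h \<in> homeo0"
  shows "lift s h \<in> Diff k (S_a k a) (S_a k b) \<longleftrightarrow> h \<in> Hk k s a b"
proof -
  have m: "w b \<circ> h \<circ> w (1 / a) \<in> homeo0" "w b \<circ> h \<in> homeo0" "h \<circ> w (1 / a) \<in> homeo0"
    using a b h by (simp_all add: homeo0_comp w_homeo0)
  have "homeomorphic_map Ltop Ltop (lift s h)" using h homeomorphic_map_L_iff by blast
  then show ?thesis
    unfolding Diff_def Hk_def mem_Collect_eq inv_lift[OF h] Ck_map_lift[OF a b h]
      Ck_map_lift[OF b a homeo0_inv[OF h]] Dk_iff inv_conj_w[OF a b h]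
    using h m by auto
qed

lemma Diff_S_a:
  assumes "a > 0" "b > 0"
  shows "Diff k (S_a k a) (S_a k b) = {lift s h | s h. h \<in> Hk k s a b}"
proof -
  have "\<exists>s. \<exists>h\<in>homeo0. f = lift s h" if "f \<in> Diff k (S_a k a) (S_a k b)" for f
    using that homeomorphic_map_L_iff by (auto simp: Diff_def)
  then show ?thesis
    using lift_in_Diff_iff[OF assms] Hk_homeo0[OF assms(2)] by blast
qed

lemma Diff_sub_S_a:
  assumes "a > 0" "b > 0"
  shows "Diff_sub k pos s (S_a k a) (S_a k b) =
    lift s ` {h \<in> Hk k s a b. if pos then strict_mono h else strict_antimono_on UNIV h}"
  unfolding Diff_sub_def Diff_S_a[OF assms]
  using orient_pres_lift orient_rev_lift fixes_origins_lift exchanges_origins_lift Hk_homeo0[OF assms(2)]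
  by (cases pos; cases s) (auto simp: image_iff)

section \<open>Derivatives at the origin and the matching of parameters\<close>

lemma Dk_Cn_on: "h \<in> Dk k \<Longrightarrow> enat n \<le> k \<Longrightarrow> Cn_on n UNIV h"
  by (simp add: Dk_def Ck_on_def)

text \<open>The chain rule for \<open>inv h \<circ> h = id\<close> exhibits an inverse of the
  derivative; order at least one makes both maps differentiable.\<close>

lemma Dk_deriv_nonzero:
  assumes "h \<in> Dk k" "k \<ge> 1"
  shows "deriv h x \<noteq> 0"
proof -
  have k: "enat 1 \<le> k" using assms(2) by (simp add: one_enat_def)
  have "(h has_real_derivative deriv h x) (at x)"
    using Dk_Cn_on[OF assms(1) k] Cn_on_iff_deriv[of UNIV 1 h] by auto
  moreover have "(inv h has_real_derivative deriv (inv h) (h x)) (at (h x))"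
    using Dk_Cn_on[OF Dk_inv[OF assms(1)] k] Cn_on_iff_deriv[of UNIV 1 "inv h"] by auto
  ultimately have "((\<lambda>y. inv h (h y)) has_real_derivative deriv (inv h) (h x) * deriv h x) (at x)"
    by (intro DERIV_chain2)
  moreover have "(\<lambda>y. inv h (h y)) = (\<lambda>y. y)" using assms(1) by (auto simp: Dk_def bij_is_inj)
  ultimately have "deriv (inv h) (h x) * deriv h x = 1"
    using DERIV_unique DERIV_ident by metis
  then show ?thesis by auto
qed

text \<open>Comparing one-sided derivatives at \<open>0\<close>: on the two half-lines the conjugate of \<open>h\<close> by the \<open>w\<close>'s is a
  rescaling of \<open>h\<close>, with different factors.\<close>

lemma conj_w_increasing:
  assumes k: "k \<ge> 1" and a: "a > 0" and b: "b > 0"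
    and h: "h \<in> Dk k" "w b \<circ> h \<circ> w (1 / a) \<in> Dk k" "strict_mono h"
  shows "a = b" "a \<noteq> 1 \<Longrightarrow> h \<in> Ek_plus k"
proof -
  have k1: "enat 1 \<le> k" using k by (simp add: one_enat_def)
  let ?g = "w b \<circ> h \<circ> w (1 / a)"
  have h0: "h 0 = 0" using h(1) by (simp add: Dk_def)
  have left: "?g x = h x" if "x < 0" for x
    using strict_monoD[OF h(3) that] that h0 by (simp add: w_def)
  have right: "?g x = b * h (1 / a * x)" if "x > 0" for x
    using strict_monoD[OF h(3), of 0 "x / a"] that h0 a by (simp add: w_def)
  have eq: "(deriv ^^ i) h 0 = b * (1 / a) ^ i * (deriv ^^ i) h 0" if i: "enat i \<le> k" for i
  proof -
    note C = Dk_Cn_on[OF h(1) i] Dk_Cn_on[OF h(2) i]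
    have "(deriv ^^ i) ?g 0 = (deriv ^^ i) h 0"
      by (rule deriv_funpow_eq_left[OF C(2) C(1) left order_refl])
    moreover have "(deriv ^^ i) ?g 0 = (deriv ^^ i) (\<lambda>x. b * h (1 / a * x)) 0"
      by (rule deriv_funpow_eq_right[OF C(2) Cn_on_scale[OF C(1)] right order_refl])
    ultimately show ?thesis using deriv_funpow_scale[OF C(1), of i b "1 / a" 0] by simp
  qed
  \<comment> \<open>At order one the derivative is nonzero, hence cancels and leaves
    \<open>1 = b / a\<close>.\<close>
  show ab: "a = b" using eq[OF k1] Dk_deriv_nonzero[OF h(1) k, of 0] a by (simp add: field_simps)
  assume "a \<noteq> 1"
  have "(deriv ^^ i) h 0 = 0" if i: "2 \<le> i" "enat i \<le> k" for i
  proof (rule ccontr)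
    assume nz: "(deriv ^^ i) h 0 \<noteq> 0"
    \<comment> \<open>With \<open>a = b\<close> the factor is a^(1-i), so a nonzero derivative would
      force \<open>a ^ j = 1\<close> for the positive \<open>j = i - 1\<close>.\<close>
    obtain j where j: "i = Suc j" "j > 0" using i(1) by (cases i) auto
    have "a ^ j = 1" using eq[OF i(2)] nz ab a by (simp add: j field_simps)
    then have "a = 1" using power_eq_imp_eq_base[of a j 1] a j(2) by simp
    then show False using \<open>a \<noteq> 1\<close> by simp
  qed
  then show "h \<in> Ek_plus k" using h by (simp add: Ek_plus_def Dk_plus_def)
qed

text \<open>A decreasing \<open>h\<close> swaps the half-lines, so \<open>w b\<close> rescales on
  the left and \<open>w (1 / a)\<close> on the right: the one-sided slopes at 0 are \<open>b\<close>
  times, respectively \<open>1 / a\<close> times, that of \<open>h\<close>.\<close>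

lemma conj_w_decreasing:
  assumes k: "k \<ge> 1" and a: "a > 0" and b: "b > 0"
    and h: "h \<in> Dk k" "w b \<circ> h \<circ> w (1 / a) \<in> Dk k" "strict_antimono_on UNIV h"
  shows "a = 1 / b"
proof -
  have k1: "enat 1 \<le> k" using k by (simp add: one_enat_def)
  let ?g = "w b \<circ> h \<circ> w (1 / a)"
  have h0: "h 0 = 0" using h(1) by (simp add: Dk_def)
  have left: "?g x = b * h (1 * x)" if "x < 0" for x
    using monotone_onD[OF h(3), of x 0] that h0 by (simp add: w_def)
  have right: "?g x = 1 * h (1 / a * x)" if "x > 0" for x
    using monotone_onD[OF h(3), of 0 "x / a"] that h0 a by (simp add: w_def)
  note C = Dk_Cn_on[OF h(1) k1] Dk_Cn_on[OF h(2) k1]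
  have "(deriv ^^ 1) ?g 0 = (deriv ^^ 1) (\<lambda>x. b * h (1 * x)) 0"
    by (rule deriv_funpow_eq_left[OF C(2) Cn_on_scale[OF C(1)] left order_refl])
  moreover have "(deriv ^^ 1) ?g 0 = (deriv ^^ 1) (\<lambda>x. 1 * h (1 / a * x)) 0"
    by (rule deriv_funpow_eq_right[OF C(2) Cn_on_scale[OF C(1)] right order_refl])
  ultimately have "b * deriv h 0 = 1 / a * deriv h 0"
    using deriv_funpow_scale[OF C(1), of 1 b 1 0] deriv_funpow_scale[OF C(1), of 1 1 "1 / a" 0] by simp
  then show ?thesis using Dk_deriv_nonzero[OF h(1) k, of 0] a b by (simp add: field_simps)
qed

text \<open>The conjugate is \<open>h\<close> on the left and \<open>a * h (x / a)\<close> on the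
  right. First derivatives at 0 agree because the factors cancel, higher ones because they vanish,
  so the two halves glue.\<close>

lemma Ek_plus_conj_w:
  assumes k: "k \<ge> 1" and a: "a > 0" and h: "h \<in> Ek_plus k"
  shows "w a \<circ> h \<circ> w (1 / a) \<in> Dk k"
proof -
  have k1: "enat 1 \<le> k" using k by (simp add: one_enat_def)
  define g where "g = w a \<circ> h \<circ> w (1 / a)"
  have hD: "h \<in> Dk k" and mono: "strict_mono h" using h by (auto simp: Ek_plus_def Dk_plus_def)
  have h0: "h 0 = 0" using hD by (simp add: Dk_def)
  have left: "g x = h x" if "x \<le> 0" for x
    using strict_mono_less_eq[OF mono, of x 0] that h0 by (simp add: g_def w_def)
  have right: "g x = a * h (1 / a * x)" if "x > 0" for x
    using strict_monoD[OF mono, of 0 "x / a"] that h0 a by (simp add: g_def w_def)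
  have g: "g = (\<lambda>x. if x \<le> 0 then h x else a * h (1 / a * x))"
    using left right by (intro ext) simp
  have C: "Cn_on n UNIV g" if n: "enat n \<le> k" for n
    unfolding g
  proof (rule Cn_on_glue)
    note hn = Dk_Cn_on[OF hD n]
    show "Cn_on n UNIV h" "Cn_on n UNIV (\<lambda>x. a * h (1 / a * x))" by (rule hn, rule Cn_on_scale[OF hn])
    fix i assume i: "i \<le> n"
    then have "enat i \<le> k" using n order_trans[of "enat i" "enat n" k] by simp
    then have flat: "(deriv ^^ i) h 0 = 0" if "2 \<le> i" using h that by (simp add: Ek_plus_def)
    have "(deriv ^^ i) h 0 = a * (1 / a) ^ i * (deriv ^^ i) h (1 / a * 0)"
    proof (cases "2 \<le> i")
      case True
      then show ?thesis using flat by simp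
    next
      case False
      then consider "i = 0" | "i = 1" by linarith
      then show ?thesis using h0 a by cases simp_all
    qed
    then show "(deriv ^^ i) h 0 = (deriv ^^ i) (\<lambda>x. a * h (1 / a * x)) 0"
      by (simp only: deriv_funpow_scale[OF hn i])
  qed
  have gh: "g \<in> homeo0" unfolding g_def using a by (intro homeo0_comp w_homeo0 Dk_homeo0[OF hD]) auto
  \<comment> \<open>Nonvanishing transfers from \<open>h\<close> on either side and at 0; through
    \<open>Cn_on_inv\<close> it makes the inverse as smooth as \<open>g\<close>.\<close>
  have "deriv g x \<noteq> 0" for x
  proof -
    consider "x < 0" | "x = 0" | "x > 0" by linarith
    then show ?thesis
    proof cases
      case 1
      then show ?thesis
        using deriv_funpow_cong_open[of "{..<0}" g h x 1] left Dk_deriv_nonzero[OF hD k] by simp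
    next
      case 2
      then show ?thesis
        using deriv_funpow_eq_left[OF C[OF k1] Dk_Cn_on[OF hD k1], of 1] left Dk_deriv_nonzero[OF hD k] by simp
    next
      case 3
      then show ?thesis
        using deriv_funpow_cong_open[of "{0<..}" g "\<lambda>x. a * h (1 / a * x)" x 1] right
          deriv_funpow_scale[OF Dk_Cn_on[OF hD k1], of 1 a "1 / a" x] Dk_deriv_nonzero[OF hD k] a by simp
    qed
  qed
  then have "Cn_on n UNIV (inv g)" if "enat n \<le> k" for n
    using Cn_on_inv[of g n] C[OF that] gh by (cases "n = 0") (auto simp: homeo0_def Cn_on_0)
  then show ?thesis using gh C by (auto simp: Dk_iff Ck_on_def simp flip: g_def)
qed

section \<open>The groupoid of diffeomorphisms\<close>

lemma not_strict_mono_and_antimono: "\<not> (strict_mono h \<and> strict_antimono_on UNIV h)"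
  for h :: "real \<Rightarrow> real"
  using monotone_onD[of UNIV "(<)" "(<)" h 1 2] monotone_onD[of UNIV "(<)" "(>)" h 1 2] by auto

lemma homeo0_antimono_iff: "h \<in> homeo0 \<Longrightarrow> strict_antimono_on UNIV h \<longleftrightarrow> \<not> strict_mono h"
  using homeo0_monotone not_strict_mono_and_antimono by blast

lemma homeo0_strict_mono_comp:
  assumes "g \<in> homeo0" "h \<in> homeo0"
  shows "strict_mono (g \<circ> h) \<longleftrightarrow> (strict_mono g \<longleftrightarrow> strict_mono h)"
proof -
  have "strict_mono (g \<circ> h)" if "strict_mono g" "strict_mono h"
    using that by (simp add: strict_mono_def)
  moreover have "strict_mono (g \<circ> h)" if "strict_antimono_on UNIV g" "strict_antimono_on UNIV h"
    using that by (simp add: monotone_on_def)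
  moreover have "strict_antimono_on UNIV (g \<circ> h)" if "strict_mono g" "strict_antimono_on UNIV h"
    using that by (simp add: monotone_on_def)
  moreover have "strict_antimono_on UNIV (g \<circ> h)" if "strict_antimono_on UNIV g" "strict_mono h"
    using that by (simp add: monotone_on_def)
  ultimately show ?thesis
    using homeo0_antimono_iff assms homeo0_comp[OF assms] by blast
qed

lemma strict_mono_id_real: "strict_mono (id :: real \<Rightarrow> real)"
  by (simp add: strict_mono_def)

lemma homeo0_strict_mono_inv:
  assumes "h \<in> homeo0"
  shows "strict_mono (inv h) \<longleftrightarrow> strict_mono h"
  using homeo0_strict_mono_comp[OF assms homeo0_inv[OF assms]] assms strict_mono_id_real by simp

lemma Hk_id: "a > 0 \<Longrightarrow> id \<in> Hk k True a a"
  by (simp add: Hk_def Dk_id)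

text \<open>Each chart expression of the composite splits through the chart around the intermediate
  origin; if that is the second origin, \<open>w (1 / b)\<close> cancels \<open>w b\<close>. The
  identities list the splittings for the four combinations of \<open>t\<close> and
  \<open>s\<close>.\<close>

lemma Hk_comp:
  assumes "b > 0" "g \<in> Hk k t b c" "h \<in> Hk k s a b"
  shows "g \<circ> h \<in> Hk k (t = s) a c"
proof -
  have [simp]: "w (1 / b) (w b x) = x" for x using assms(1) by simp
  have "(w c \<circ> g \<circ> w (1 / b)) \<circ> (w b \<circ> h \<circ> w (1 / a)) = w c \<circ> (g \<circ> h) \<circ> w (1 / a)"
    "(w c \<circ> g \<circ> w (1 / b)) \<circ> (w b \<circ> h) = w c \<circ> (g \<circ> h)"
    "g \<circ> (h \<circ> w (1 / a)) = g \<circ> h \<circ> w (1 / a)"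
    "(w c \<circ> g) \<circ> h = w c \<circ> (g \<circ> h)"
    "(g \<circ> w (1 / b)) \<circ> (w b \<circ> h \<circ> w (1 / a)) = g \<circ> h \<circ> w (1 / a)"
    "(g \<circ> w (1 / b)) \<circ> (w b \<circ> h) = g \<circ> h"
    "(w c \<circ> g) \<circ> (h \<circ> w (1 / a)) = w c \<circ> (g \<circ> h) \<circ> w (1 / a)"
    by (auto simp del: w_inverse)
  then show ?thesis
    using assms(2,3) unfolding Hk_def mem_Collect_eq
    by (cases t; cases s; simp only: if_True if_False simp_thms) (metis Dk_comp)+
qed

lemma Hk_inv:
  assumes a: "a > 0" and b: "b > 0" and h: "h \<in> Hk k s a b"
  shows "inv h \<in> Hk k s b a"
  using h inv_conj_w[OF a b Hk_homeo0[OF b h]] unfolding Hk_def mem_Collect_eq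
  by (cases s; simp only: if_True if_False) (metis Dk_inv)+

lemma Hk_sign:
  assumes k: "k \<ge> 1" and a: "a > 0" and b: "b > 0" and h: "h \<in> Hk k s a b"
  shows "a = (if strict_mono h = s then b else 1 / b)"
proof (cases s)
  case True
  then show ?thesis
    using conj_w_increasing(1)[OF k a b] conj_w_decreasing[OF k a b] h
      homeo0_antimono_iff[OF Hk_homeo0[OF b h]] by (auto simp: Hk_def)
next
  case False
  \<comment> \<open>Reduces the exchanging case to the fixing one: the conditions on
    \<open>h\<close> for \<open>a\<close> and \<open>b\<close> become those on \<open>u\<close> for
    \<open>a\<close> and \<open>1 / b\<close>.\<close>
  define u where "u = w b \<circ> h"
  have "w (1 / b) \<circ> u = h" using b by (auto simp: u_def)
  then have u: "u \<in> Dk k" "w (1 / b) \<circ> u \<circ> w (1 / a) \<in> Dk k"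
    using h False by (auto simp: Hk_def u_def)
  have "strict_mono u \<longleftrightarrow> strict_mono h"
    unfolding u_def using homeo0_strict_mono_comp[OF w_homeo0[OF b] Hk_homeo0[OF b h]] w_mono[OF b] by simp
  then show ?thesis
    using conj_w_increasing(1)[OF k a _ u] conj_w_decreasing[OF k a _ u] False b
      homeo0_antimono_iff[OF Dk_homeo0[OF u(1)]] by (auto simp del: w_inverse)
qed

lemma Diff_sub_eq:
  assumes "a > 0" "b > 0"
  shows "Diff_sub k pos s (S_a k a) (S_a k b) = lift s ` {h \<in> Hk k s a b. strict_mono h = pos}"
  unfolding Diff_sub_S_a[OF assms]
  using homeo0_antimono_iff Hk_homeo0[OF assms(2)] by (intro arg_cong[of _ _ "image (lift s)"]) auto

lemma Diff_sub_comp: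
  assumes "a > 0" "b > 0" "c > 0"
    and "f \<in> Diff_sub k p s (S_a k b) (S_a k c)" "g \<in> Diff_sub k q t (S_a k a) (S_a k b)"
  shows "f \<circ> g \<in> Diff_sub k (p = q) (s = t) (S_a k a) (S_a k c)"
proof -
  obtain u v where u: "f = lift s u" "u \<in> Hk k s b c" "strict_mono u = p"
    and v: "g = lift t v" "v \<in> Hk k t a b" "strict_mono v = q"
    using assms by (auto simp: Diff_sub_eq)
  have h: "u \<in> homeo0" "v \<in> homeo0" using u v Hk_homeo0 assms by blast+
  show ?thesis
    using Hk_comp[OF assms(2) u(2) v(2)] homeo0_strict_mono_comp[OF h] u v assms
    by (simp add: Diff_sub_eq lift_comp[OF h(1)])
qed

lemma Diff_sub_inv:
  assumes "a > 0" "b > 0" "f \<in> Diff_sub k p s (S_a k a) (S_a k b)"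
  shows "inv f \<in> Diff_sub k p s (S_a k b) (S_a k a)" "inv f \<circ> f = id" "f \<circ> inv f = id"
proof -
  obtain u where u: "f = lift s u" "u \<in> Hk k s a b" "strict_mono u = p"
    using assms by (auto simp: Diff_sub_eq)
  note h = Hk_homeo0[OF assms(2) u(2)]
  show "inv f \<in> Diff_sub k p s (S_a k b) (S_a k a)"
    using Hk_inv[OF assms(1,2) u(2)] homeo0_strict_mono_inv[OF h] u assms
    by (simp add: Diff_sub_eq inv_lift[OF h])
  show "inv f \<circ> f = id" "f \<circ> inv f = id"
    using h homeo0_inv[OF h] by (simp_all add: u(1) inv_lift lift_comp)
qed

lemma Diff_eq_Un_Diff_sub:
  assumes "a > 0" "b > 0"
  shows "Diff k (S_a k a) (S_a k b) = (\<Union>p. \<Union>s. Diff_sub k p s (S_a k a) (S_a k b))"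
  using assms by (auto simp: Diff_S_a Diff_sub_eq)

lemma Diff_sub_disjoint:
  assumes "a > 0" "b > 0" "f \<in> Diff_sub k p s (S_a k a) (S_a k b)" "f \<in> Diff_sub k q t (S_a k a) (S_a k b)"
  shows "p = q" "s = t"
proof -
  obtain u v where u: "f = lift s u" "u \<in> Hk k s a b" "strict_mono u = p"
    and v: "f = lift t v" "v \<in> Hk k t a b" "strict_mono v = q"
    using assms(3,4) unfolding Diff_sub_eq[OF assms(1,2)] by blast
  have "u 0 = 0" "v 0 = 0" using u v Hk_homeo0 assms(2) by (auto simp: homeo0_def)
  then have "s = t \<and> u = v" using u(1) v(1) lift_eq_iff[of u v s t] by simp
  then show "p = q" "s = t" using u(3) v(3) by auto
qed

lemma Diff_sub_nonempty_imp:
  assumes "k \<ge> 1" "a > 0" "b > 0" "f \<in> Diff_sub k p s (S_a k a) (S_a k b)"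
  shows "a = (if p = s then b else 1 / b)"
proof -
  obtain u where "u \<in> Hk k s a b" "strict_mono u = p" using assms(2-4) by (auto simp: Diff_sub_eq)
  then show ?thesis using Hk_sign[OF assms(1-3)] by metis
qed

lemma id_in_Diff_sub: "a > 0 \<Longrightarrow> id \<in> Diff_sub k True True (S_a k a) (S_a k a)"
  using Hk_id[of a k] strict_mono_id_real by (auto simp: Diff_sub_eq image_iff intro!: bexI[of _ id])

section \<open>Group structure of the diffeomorphisms of a single \<open>S_a\<close>\<close>

definition hat :: "(L \<Rightarrow> L) \<Rightarrow> real \<Rightarrow> real" where
  "hat f = real_of_L \<circ> f \<circ> Pt"

lemma hat_lift [simp]: "hat (lift s h) = h"
  by (auto simp: hat_def)

text \<open>Since \<open>w 1 = id\<close>, both conditions in \<open>Hk\<close> reduce to membership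
  in \<open>Dk\<close>, whatever \<open>s\<close> is; so \<open>h\<close> and the sign vary
  independently and the group is a direct product.\<close>

lemma Diff_S_1_iso:
  "\<exists>\<eta> :: (L \<Rightarrow> L) \<Rightarrow> (real \<Rightarrow> real) \<times> int.
      bij_betw \<eta> (Diff k (S_a k 1) (S_a k 1)) (Dk k \<times> Z2) \<and>
      (\<forall>f\<in>Diff k (S_a k 1) (S_a k 1). \<forall>g\<in>Diff k (S_a k 1) (S_a k 1).
         \<eta> (f \<circ> g) = (fst (\<eta> f) \<circ> fst (\<eta> g), snd (\<eta> f) * snd (\<eta> g))) \<and>
      \<eta> ` Diff_sub k True True (S_a k 1) (S_a k 1) = Dk_plus k \<times> {1} \<and>
      \<eta> ` Diff_sub k False True (S_a k 1) (S_a k 1) = Dk_minus k \<times> {1} \<and>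
      \<eta> ` Diff_sub k True False (S_a k 1) (S_a k 1) = Dk_plus k \<times> {-1} \<and>
      \<eta> ` Diff_sub k False False (S_a k 1) (S_a k 1) = Dk_minus k \<times> {-1}"
proof -
  define \<eta> :: "(L \<Rightarrow> L) \<Rightarrow> (real \<Rightarrow> real) \<times> int"
    where "\<eta> f = (hat f, if f Org2 = Org2 then 1 else -1)" for f
  have \<eta>: "\<eta> (lift s h) = (h, if s then 1 else -1)" for s h by (simp add: \<eta>_def)
  have H: "Hk k s 1 1 = Dk k" for s by (auto simp: Hk_def)
  have D: "Diff k (S_a k 1) (S_a k 1) = {lift s h | s h. h \<in> Dk k}" by (simp add: Diff_S_a H)
  have im: "\<eta> ` lift s ` A = A \<times> {if s then 1 else -1}" for s A by (auto simp: image_image \<eta>)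
  have plus: "{h \<in> Dk k. strict_mono h} = Dk_plus k" "{h \<in> Dk k. \<not> strict_mono h} = Dk_minus k"
    using homeo0_antimono_iff Dk_homeo0 by (auto simp: Dk_plus_def Dk_minus_def)
  have "bij_betw \<eta> {lift s h | s h. h \<in> Dk k} (Dk k \<times> Z2)"
    by (rule bij_betw_byWitness[where f' = "\<lambda>(h, e). lift (e = 1) h"]) (auto simp: \<eta> Z2_def)
  moreover have "\<eta> (f \<circ> g) = (fst (\<eta> f) \<circ> fst (\<eta> g), snd (\<eta> f) * snd (\<eta> g))"
    if "f \<in> {lift s h | s h. h \<in> Dk k}" "g \<in> {lift s h | s h. h \<in> Dk k}" for f g
    using that by (auto simp: \<eta> lift_comp Dk_homeo0 simp del: o_apply)
  ultimately show ?thesis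
    by (intro exI[of _ \<eta>]) (simp add: D Diff_sub_eq H im plus)
qed

lemma Hk_increasing_eq_Ek_plus:
  assumes "k \<ge> 1" "a > 0" "a \<noteq> 1"
  shows "{h \<in> Hk k True a a. strict_mono h} = Ek_plus k"
  using conj_w_increasing(2)[OF assms(1,2,2)] Ek_plus_conj_w[OF assms(1,2)] assms(3)
  by (auto simp: Hk_def Ek_plus_def Dk_plus_def)

lemma neq_inverse:
  fixes a :: real
  assumes "a > 0" "a \<noteq> 1"
  shows "a \<noteq> 1 / a"
proof
  assume "a = 1 / a"
  then have "a ^ 2 = 1 ^ 2" using assms by (simp add: power2_eq_square field_simps)
  then show False using assms power2_eq_imp_eq[of a 1] by simp
qed

text \<open>The factor \<open>sqrt a\<close> balances the two slopes: in the charts around the origins, the involution is linear.\<close>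

definition flip :: "real \<Rightarrow> real \<Rightarrow> real" where
  "flip a = w (1 / a) \<circ> (\<lambda>x. - sqrt a * x)"

lemma flip_eq: "a > 0 \<Longrightarrow> flip a x = (if x \<le> 0 then - x / sqrt a else - sqrt a * x)"
  by (auto simp: flip_def w_def field_simps zero_le_mult_iff mult_le_0_iff)

lemma flip_flip: "a > 0 \<Longrightarrow> flip a \<circ> flip a = id"
  by (auto simp: flip_eq fun_eq_iff field_simps zero_le_divide_iff mult_le_0_iff)

lemma flip_in_Hk: "a > 0 \<Longrightarrow> flip a \<in> Hk k False a a"
proof -
  assume a: "a > 0"
  have "w a \<circ> flip a = (\<lambda>x. - sqrt a * x)" using a by (auto simp: flip_def)
  moreover have "flip a \<circ> w (1 / a) = (\<lambda>x. - (1 / sqrt a) * x)"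
    using a real_sqrt_mult_self[of a]
    by (auto simp: flip_eq w_def fun_eq_iff field_simps divide_le_0_iff)
  ultimately show ?thesis
    using a Dk_linear[of "- sqrt a" k] Dk_linear[of "- (1 / sqrt a)" k] by (simp add: Hk_def)
qed

lemma flip_not_mono: "a > 0 \<Longrightarrow> \<not> strict_mono (flip a)"
  using strict_monoD[of "flip a" 1 2] by (auto simp: flip_eq)

text \<open>A component with \<open>p = s\<close> can be nonempty only for \<open>a = b\<close>, any
  other only for \<open>a = 1 / b\<close>. The flag \<open>r\<close> selects the surviving pair:
  \<open>True\<close> will serve equal parameters, \<open>False\<close> inverse ones.\<close>

lemma Diff_eq_two_Diff_subs:
  assumes "k \<ge> 1" "a > 0" "b > 0" "a \<noteq> (if r then 1 / b else b)"
  shows "Diff_sub k True (\<not> r) (S_a k a) (S_a k b) = {}" "Diff_sub k False r (S_a k a) (S_a k b) = {}"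
    "Diff k (S_a k a) (S_a k b) =
      Diff_sub k True r (S_a k a) (S_a k b) \<union> Diff_sub k False (\<not> r) (S_a k a) (S_a k b)"
    "Diff_sub k True r (S_a k a) (S_a k b) \<inter> Diff_sub k False (\<not> r) (S_a k a) (S_a k b) = {}"
proof -
  have e: "Diff_sub k p s (S_a k a) (S_a k b) = {}" if "(p = s) \<noteq> r" for p s
  proof (rule equals0I)
    fix f assume "f \<in> Diff_sub k p s (S_a k a) (S_a k b)"
    from Diff_sub_nonempty_imp[OF assms(1-3) this] show False
      using assms(4) that by (cases r; cases "p = s") auto
  qed
  show "Diff_sub k True (\<not> r) (S_a k a) (S_a k b) = {}" "Diff_sub k False r (S_a k a) (S_a k b) = {}"
    by (rule e, simp)+
  have "Diff_sub k p s (S_a k a) (S_a k b) \<subseteq>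
      Diff_sub k True r (S_a k a) (S_a k b) \<union> Diff_sub k False (\<not> r) (S_a k a) (S_a k b)" for p s
    using e[of p s] by (cases p; cases s; cases r) auto
  then show "Diff k (S_a k a) (S_a k b) =
      Diff_sub k True r (S_a k a) (S_a k b) \<union> Diff_sub k False (\<not> r) (S_a k a) (S_a k b)"
    unfolding Diff_eq_Un_Diff_sub[OF assms(2,3)] by blast
  show "Diff_sub k True r (S_a k a) (S_a k b) \<inter> Diff_sub k False (\<not> r) (S_a k a) (S_a k b) = {}"
    using Diff_sub_disjoint(1)[OF assms(2,3)] by blast
qed

lemma Diff_S_a_a:
  assumes "k \<ge> 1" "a > 0" "a \<noteq> 1"
  shows "Diff_sub k True False (S_a k a) (S_a k a) = {}" "Diff_sub k False True (S_a k a) (S_a k a) = {}"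
    "Diff k (S_a k a) (S_a k a) =
      Diff_sub k True True (S_a k a) (S_a k a) \<union> Diff_sub k False False (S_a k a) (S_a k a)"
    "Diff_sub k True True (S_a k a) (S_a k a) \<inter> Diff_sub k False False (S_a k a) (S_a k a) = {}"
  using Diff_eq_two_Diff_subs[OF assms(1,2,2), of True] neq_inverse[OF assms(2,3)] by simp_all

lemma Diff_sub_fix_eq_lift_Ek_plus:
  assumes "k \<ge> 1" "a > 0" "a \<noteq> 1"
  shows "Diff_sub k True True (S_a k a) (S_a k a) = lift True ` Ek_plus k"
  using Hk_increasing_eq_Ek_plus[OF assms] by (simp add: Diff_sub_eq assms(2))

lemma Diff_sub_fix_iso_Ek_plus:
  assumes "k \<ge> 1" "a > 0" "a \<noteq> 1"
  shows "\<exists>\<psi> :: (L \<Rightarrow> L) \<Rightarrow> (real \<Rightarrow> real).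
        bij_betw \<psi> (Diff_sub k True True (S_a k a) (S_a k a)) (Ek_plus k) \<and>
        (\<forall>f\<in>Diff_sub k True True (S_a k a) (S_a k a). \<forall>g\<in>Diff_sub k True True (S_a k a) (S_a k a).
           \<psi> (f \<circ> g) = \<psi> f \<circ> \<psi> g)"
proof (intro exI[of _ hat] conjI ballI)
  show "bij_betw hat (Diff_sub k True True (S_a k a) (S_a k a)) (Ek_plus k)"
    unfolding Diff_sub_fix_eq_lift_Ek_plus[OF assms]
    by (rule bij_betw_byWitness[where f' = "lift True"]) auto
next
  fix f g assume "f \<in> Diff_sub k True True (S_a k a) (S_a k a)" "g \<in> Diff_sub k True True (S_a k a) (S_a k a)"
  then obtain u v where "f = lift True u" "g = lift True v" "u \<in> Ek_plus k"
    unfolding Diff_sub_fix_eq_lift_Ek_plus[OF assms] by auto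
  moreover then have "u \<in> homeo0" by (auto simp: Ek_plus_def Dk_plus_def Dk_homeo0)
  ultimately show "hat (f \<circ> g) = hat f \<circ> hat g" by (simp add: lift_comp)
qed

lemma flip_in_Diff_sub: "a > 0 \<Longrightarrow> lift False (flip a) \<in> Diff_sub k False False (S_a k a) (S_a k a)"
  using flip_in_Hk flip_not_mono by (auto simp: Diff_sub_eq)

lemma flip_homeo0: "a > 0 \<Longrightarrow> flip a \<in> homeo0"
  using flip_in_Hk Hk_homeo0 by blast

lemma lift_flip_involution: "a > 0 \<Longrightarrow> lift False (flip a) \<circ> lift False (flip a) = id"
  by (simp add: lift_comp flip_homeo0 flip_flip)

text \<open>The increasing, origin-fixing part is the kernel of the sign, hence normal; the lifted
  flip is an involution in the only other coset, so it generates a complement.\<close>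

lemma Diff_S_a_semidirect:
  assumes k: "k \<ge> 1" and a: "a > 0" "a \<noteq> 1"
  shows "\<exists>p\<in>Diff_sub k False False (S_a k a) (S_a k a).
        p \<circ> p = id \<and> p \<noteq> id \<and>
        (\<forall>f\<in>Diff k (S_a k a) (S_a k a). \<forall>n\<in>Diff_sub k True True (S_a k a) (S_a k a).
           f \<circ> n \<circ> inv f \<in> Diff_sub k True True (S_a k a) (S_a k a)) \<and>
        Diff k (S_a k a) (S_a k a) =
          {n \<circ> q | n q. n \<in> Diff_sub k True True (S_a k a) (S_a k a) \<and> q \<in> {id, p}} \<and>
        Diff_sub k True True (S_a k a) (S_a k a) \<inter> {id, p} = {id}"
proof -
  define p where "p = lift False (flip a)"
  let ?D = "\<lambda>q s. Diff_sub k q s (S_a k a) (S_a k a)"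
  note D = Diff_S_a_a[OF k a] and comp = Diff_sub_comp[OF a(1) a(1) a(1)]
  have p: "p \<in> ?D False False" "p \<circ> p = id"
    unfolding p_def by (rule flip_in_Diff_sub[OF a(1)], rule lift_flip_involution[OF a(1)])
  have id: "id \<in> ?D True True" using a(1) by (rule id_in_Diff_sub)
  have "f \<circ> n \<circ> inv f \<in> ?D True True" if f: "f \<in> Diff k (S_a k a) (S_a k a)" and n: "n \<in> ?D True True" for f n
  proof -
    obtain q s where q: "f \<in> ?D q s" using f unfolding Diff_eq_Un_Diff_sub[OF a(1) a(1)] by blast
    \<comment> \<open>\<open>f\<close> and \<open>inv f\<close> carry the same signs, so these
      cancel in the conjugate.\<close>
    then show ?thesis using comp[OF comp[OF q n] Diff_sub_inv(1)[OF a(1) a(1) q]] by simp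
  qed
  moreover have "Diff k (S_a k a) (S_a k a) = {n \<circ> q | n q. n \<in> ?D True True \<and> q \<in> {id, p}}"
  proof (intro equalityI subsetI)
    fix f assume "f \<in> Diff k (S_a k a) (S_a k a)"
    then consider "f \<in> ?D True True" | "f \<in> ?D False False" using D(3) by blast
    then show "f \<in> {n \<circ> q | n q. n \<in> ?D True True \<and> q \<in> {id, p}}"
    proof cases
      case 1
      moreover have "f = f \<circ> id" by simp
      ultimately show ?thesis by blast
    next
      case 2
      have "f \<circ> p \<in> ?D True True" using comp[OF 2 p(1)] by simp
      moreover have "f = (f \<circ> p) \<circ> p" using p(2) by (simp add: comp_assoc)
      ultimately show ?thesis by blast
    qed
  next
    fix f assume "f \<in> {n \<circ> q | n q. n \<in> ?D True True \<and> q \<in> {id, p}}"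
    then obtain n q where n: "f = n \<circ> q" "n \<in> ?D True True" "q = id \<or> q = p" by blast
    then have "f \<in> ?D True True \<union> ?D False False" using comp[OF n(2) p(1)] by auto
    then show "f \<in> Diff k (S_a k a) (S_a k a)" using D(3) by blast
  qed
  moreover have "?D True True \<inter> {id, p} = {id}" "p \<noteq> id" using D(4) p(1) id by blast+
  ultimately show ?thesis using p by (intro bexI[of _ p]) auto
qed

text \<open>An exchanging diffeomorphism is recorded as \<open>h \<circ> P\<close>, the involution
  being split off on the right. Moving \<open>P\<close> past an element of \<open>Ek_plus\<close>
  conjugates that element, which is the twist \<open>\<sigma>\<close>; no \<open>inv\<close> occurs
  as \<open>P\<close> is its own inverse.\<close>

lemma Diff_S_a_iso_semidirect:
  assumes k: "k \<ge> 1" and a: "a > 0" "a \<noteq> 1"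
  shows "\<exists>(\<sigma> :: (real \<Rightarrow> real) \<Rightarrow> (real \<Rightarrow> real)) (\<Phi> :: (L \<Rightarrow> L) \<Rightarrow> (real \<Rightarrow> real) \<times> int).
        bij_betw \<sigma> (Ek_plus k) (Ek_plus k) \<and>
        (\<forall>u\<in>Ek_plus k. \<forall>v\<in>Ek_plus k. \<sigma> (u \<circ> v) = \<sigma> u \<circ> \<sigma> v) \<and>
        (\<forall>u\<in>Ek_plus k. \<sigma> (\<sigma> u) = u) \<and>
        bij_betw \<Phi> (Diff k (S_a k a) (S_a k a)) (Ek_plus k \<times> Z2) \<and>
        (\<forall>f\<in>Diff k (S_a k a) (S_a k a). \<forall>g\<in>Diff k (S_a k a) (S_a k a).
           \<Phi> (f \<circ> g) = (fst (\<Phi> f) \<circ> (if snd (\<Phi> f) = 1 then fst (\<Phi> g) else \<sigma> (fst (\<Phi> g))),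
                         snd (\<Phi> f) * snd (\<Phi> g)))"
proof -
  define P where "P = flip a"
  define \<sigma> where "\<sigma> u = P \<circ> u \<circ> P" for u :: "real \<Rightarrow> real"
  define \<Phi> :: "(L \<Rightarrow> L) \<Rightarrow> (real \<Rightarrow> real) \<times> int"
    where "\<Phi> f = (if f Org2 = Org2 then (hat f, 1) else (hat f \<circ> P, -1))" for f
  have \<Phi>: "\<Phi> (lift True h) = (h, 1)" "\<Phi> (lift False h) = (h \<circ> P, -1)" for h
    by (simp_all add: \<Phi>_def)
  have PP: "P \<circ> P = id" using flip_flip[OF a(1)] by (simp add: P_def)
  have PP': "P (P x) = x" for x using fun_cong[OF PP, of x] by simp
  note hom = Hk_homeo0[OF a(1)]
  have E: "Ek_plus k = {h \<in> Hk k True a a. strict_mono h}" using Hk_increasing_eq_Ek_plus[OF k a] by simp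
  \<comment> \<open>This is the coset of \<open>Ek_plus\<close> through \<open>P\<close>: composing
    with \<open>P\<close> on the right passes back and forth.\<close>
  define F where "F = {h \<in> Hk k False a a. \<not> strict_mono h}"
  have P: "P \<in> F" using flip_in_Hk flip_not_mono a(1) by (auto simp: F_def P_def)
  have EF: "u \<circ> P \<in> F" if "u \<in> Ek_plus k" for u
    using that P Hk_comp[OF a(1), of u k True a P False a] homeo0_strict_mono_comp[OF hom hom, of u k True a P k False a]
    by (auto simp: E F_def)
  have FE: "u \<circ> v \<in> Ek_plus k" if "u \<in> F" "v \<in> F" for u v
    using that Hk_comp[OF a(1), of u k False a v False a] homeo0_strict_mono_comp[OF hom hom, of u k False a v k False a]
    by (auto simp: E F_def)
  have \<sigma>E: "\<sigma> u \<in> Ek_plus k" if "u \<in> Ek_plus k" for u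
    using FE[OF P EF[OF that]] by (simp add: \<sigma>_def comp_assoc)
  have \<sigma>\<sigma>: "\<sigma> (\<sigma> u) = u" for u by (auto simp: \<sigma>_def PP')
  have D: "Diff k (S_a k a) (S_a k a) = lift True ` Ek_plus k \<union> lift False ` F"
    using Diff_S_a_a(3)[OF k a] by (simp add: Diff_sub_eq a(1) E F_def)
  have hE: "u \<in> homeo0" if "u \<in> Ek_plus k \<or> u \<in> F" for u using that hom by (auto simp: E F_def)
  have "bij_betw \<sigma> (Ek_plus k) (Ek_plus k)"
    by (rule bij_betw_byWitness[where f' = \<sigma>]) (auto simp: \<sigma>\<sigma> \<sigma>E)
  moreover have "\<sigma> (u \<circ> v) = \<sigma> u \<circ> \<sigma> v" for u v by (auto simp: \<sigma>_def PP')
  moreover have "bij_betw \<Phi> (lift True ` Ek_plus k \<union> lift False ` F) (Ek_plus k \<times> Z2)"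
    by (rule bij_betw_byWitness[where f' = "\<lambda>(u, e). if e = 1 then lift True u else lift False (u \<circ> P)"])
       (use EF FE P in \<open>auto simp: \<Phi> Z2_def comp_assoc PP\<close>)
  moreover have "\<Phi> (f \<circ> g) = (fst (\<Phi> f) \<circ> (if snd (\<Phi> f) = 1 then fst (\<Phi> g) else \<sigma> (fst (\<Phi> g))),
                         snd (\<Phi> f) * snd (\<Phi> g))"
    if fg: "f \<in> lift True ` Ek_plus k \<union> lift False ` F" "g \<in> lift True ` Ek_plus k \<union> lift False ` F" for f g
  proof -
    obtain s u t v where f: "f = lift s u" and g: "g = lift t v" and u: "u \<in> homeo0" using fg hE by blast
    show ?thesis
      unfolding f g lift_comp[OF u] by (cases s; cases t) (auto simp: \<Phi> \<sigma>_def fun_eq_iff PP')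
  qed
  ultimately show ?thesis
    unfolding D using \<sigma>\<sigma> by (intro exI[of _ \<sigma>] exI[of _ \<Phi>]) auto
qed

section \<open>Comparison of structures with different parameters\<close>

lemma Diff_S_a_inverse:
  assumes k: "k \<ge> 1" and a: "a > 0" "a \<noteq> 1"
  shows "Diff k (S_a k a) (S_a k (1/a)) \<noteq> {}"
    "Diff_sub k True True (S_a k a) (S_a k (1/a)) = {}"
    "Diff_sub k False False (S_a k a) (S_a k (1/a)) = {}"
    "Diff k (S_a k a) (S_a k (1/a)) =
       Diff_sub k True False (S_a k a) (S_a k (1/a)) \<union> Diff_sub k False True (S_a k a) (S_a k (1/a))"
    "Diff_sub k True False (S_a k a) (S_a k (1/a)) \<inter> Diff_sub k False True (S_a k a) (S_a k (1/a)) = {}"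
proof -
  \<comment> \<open>With the origins exchanged, \<open>w a\<close> is the identity in charts: both
    \<open>w (1 / a) \<circ> w a\<close> and \<open>w a \<circ> w (1 / a)\<close> are
    \<open>id\<close>.\<close>
  have "w a \<in> Hk k False a (1 / a)" using a(1) Dk_id by (simp add: Hk_def)
  then show "Diff k (S_a k a) (S_a k (1/a)) \<noteq> {}" using a(1) by (auto simp: Diff_S_a)
  show "Diff_sub k True True (S_a k a) (S_a k (1/a)) = {}"
    "Diff_sub k False False (S_a k a) (S_a k (1/a)) = {}"
    "Diff k (S_a k a) (S_a k (1/a)) =
       Diff_sub k True False (S_a k a) (S_a k (1/a)) \<union> Diff_sub k False True (S_a k a) (S_a k (1/a))"
    "Diff_sub k True False (S_a k a) (S_a k (1/a)) \<inter> Diff_sub k False True (S_a k a) (S_a k (1/a)) = {}"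
    using Diff_eq_two_Diff_subs[OF k a(1), of "1 / a" False] neq_inverse[OF a] a(1) by simp_all
qed

lemma bij_betw_comp_Diff_sub:
  assumes a: "a > 0" and b: "b > 0" and c: "c > 0" and f: "f \<in> Diff_sub k p s (S_a k b) (S_a k c)"
  shows "bij_betw (\<lambda>\<kappa>. f \<circ> \<kappa>) (Diff_sub k q t (S_a k a) (S_a k b))
    (Diff_sub k (p = q) (s = t) (S_a k a) (S_a k c))"
proof (rule bij_betw_byWitness[where f' = "\<lambda>\<kappa>. inv f \<circ> \<kappa>"])
  note inv = Diff_sub_inv[OF b c f]
  show "\<forall>\<kappa>\<in>Diff_sub k q t (S_a k a) (S_a k b). inv f \<circ> (f \<circ> \<kappa>) = \<kappa>"
    "\<forall>\<kappa>\<in>Diff_sub k (p = q) (s = t) (S_a k a) (S_a k c). f \<circ> (inv f \<circ> \<kappa>) = \<kappa>"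
    using inv(2,3) by (simp_all flip: comp_assoc)
  show "(\<lambda>\<kappa>. f \<circ> \<kappa>) ` Diff_sub k q t (S_a k a) (S_a k b) \<subseteq> Diff_sub k (p = q) (s = t) (S_a k a) (S_a k c)"
    using Diff_sub_comp[OF a b c f] by blast
  \<comment> \<open>Multiplying twice by the same sign restores the original one, so translation by
    \<open>inv f\<close> returns to the component started from.\<close>
  have "(p = (p = q)) = q" "(s = (s = t)) = t" by auto
  then show "(\<lambda>\<kappa>. inv f \<circ> \<kappa>) ` Diff_sub k (p = q) (s = t) (S_a k a) (S_a k c) \<subseteq> Diff_sub k q t (S_a k a) (S_a k b)"
    using Diff_sub_comp[OF a c b inv(1), of _ "p = q" "s = t"] by auto
qed

lemma Diff_S_a_S_b_empty:
  assumes "k \<ge> 1" "a > 0" "b > 0" "a \<noteq> b" "a \<noteq> 1 / b"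
  shows "Diff k (S_a k a) (S_a k b) = {}"
proof (rule equals0I)
  fix f assume "f \<in> Diff k (S_a k a) (S_a k b)"
  then obtain p s where "f \<in> Diff_sub k p s (S_a k a) (S_a k b)"
    unfolding Diff_eq_Un_Diff_sub[OF assms(2,3)] by blast
  from Diff_sub_nonempty_imp[OF assms(1-3) this] show False
    using assms(4,5) by (cases "p = s") auto
qed

lemma uncountable_Ck_structures:
  assumes k: "k \<ge> 1"
  shows "\<exists>\<A> :: chart set set set. uncountable \<A> \<and> (\<forall>S\<in>\<A>. is_Ck_structure k S) \<and>
     (\<forall>S\<in>\<A>. \<forall>T\<in>\<A>. S \<noteq> T \<longrightarrow> Diff k S T = {})"
proof (intro exI[of _ "S_a k ` {1<..}"] conjI ballI impI)
  \<comment> \<open>Parameters above 1 rule out the coincidence \<open>a = 1 / b\<close>, so only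
    \<open>a = b\<close> could allow a diffeomorphism.\<close>
  have empty: "Diff k (S_a k a) (S_a k b) = {}" if "a > 1" "b > 1" "a \<noteq> b" for a b
  proof -
    have "1 / b < 1" using that by simp
    then show ?thesis using that by (intro Diff_S_a_S_b_empty[OF k]) auto
  qed
  \<comment> \<open>If two parameters gave the same structure, the identity would be a
    diffeomorphism between them.\<close>
  have inj: "inj_on (S_a k) {1<..}"
  proof (rule inj_onI, rule ccontr)
    fix a b assume ab: "a \<in> {1<..}" "b \<in> {1<..}" "S_a k a = S_a k b" "a \<noteq> b"
    then have "id \<in> Diff k (S_a k a) (S_a k b)"
      using id_in_Diff_sub[of a k] by (simp add: Diff_sub_def)
    then show False using empty[of a b] ab(1,2,4) by simp
  qed
  have "uncountable {1<..<2::real}" by (simp add: uncountable_open_interval)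
  moreover have "{1<..<2::real} \<subseteq> {1<..}" by (rule subsetI) simp
  ultimately have "uncountable {1::real<..}" using countable_subset by blast
  with inj show "uncountable (S_a k ` {1<..})" using countable_image_inj_on by blast
  show "is_Ck_structure k S" if S: "S \<in> S_a k ` {1<..}" for S
  proof -
    obtain a where "1 < a" "S = Ck_struct_of k (special_atlas (w a))" using S by (auto simp: S_a_def)
    moreover then have "Ck_atlas k (special_atlas (w a))" by (intro Ck_atlas_special) simp
    ultimately show ?thesis unfolding is_Ck_structure_def by blast
  qed
  show "Diff k S T = {}" if "S \<in> S_a k ` {1<..}" "T \<in> S_a k ` {1<..}" "S \<noteq> T" for S T
    using that empty by auto
qed

theorem theorem1p7:
  fixes k :: enat
  assumes k: "k \<ge> 1"
  shows
  \<comment> \<open>(1)\<close>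
  "(\<exists>\<eta> :: (L \<Rightarrow> L) \<Rightarrow> (real \<Rightarrow> real) \<times> int.
      bij_betw \<eta> (Diff k (S_a k 1) (S_a k 1)) (Dk k \<times> Z2) \<and>
      (\<forall>f\<in>Diff k (S_a k 1) (S_a k 1). \<forall>g\<in>Diff k (S_a k 1) (S_a k 1).
         \<eta> (f \<circ> g) = (fst (\<eta> f) \<circ> fst (\<eta> g), snd (\<eta> f) * snd (\<eta> g))) \<and>
      \<eta> ` Diff_sub k True True (S_a k 1) (S_a k 1) = Dk_plus k \<times> {1} \<and>
      \<eta> ` Diff_sub k False True (S_a k 1) (S_a k 1) = Dk_minus k \<times> {1} \<and>
      \<eta> ` Diff_sub k True False (S_a k 1) (S_a k 1) = Dk_plus k \<times> {-1} \<and>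
      \<eta> ` Diff_sub k False False (S_a k 1) (S_a k 1) = Dk_minus k \<times> {-1})
   \<and>
  \<comment> \<open>(2)\<close>
  (\<forall>a::real. a > 0 \<and> a \<noteq> 1 \<longrightarrow>
     Diff_sub k True False (S_a k a) (S_a k a) = {} \<and>
     Diff_sub k False True (S_a k a) (S_a k a) = {} \<and>
     Diff k (S_a k a) (S_a k a) =
       Diff_sub k True True (S_a k a) (S_a k a) \<union> Diff_sub k False False (S_a k a) (S_a k a) \<and>
     Diff_sub k True True (S_a k a) (S_a k a) \<inter> Diff_sub k False False (S_a k a) (S_a k a) = {} \<and>
     (\<exists>\<psi> :: (L \<Rightarrow> L) \<Rightarrow> (real \<Rightarrow> real).
        bij_betw \<psi> (Diff_sub k True True (S_a k a) (S_a k a)) (Ek_plus k) \<and>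
        (\<forall>f\<in>Diff_sub k True True (S_a k a) (S_a k a). \<forall>g\<in>Diff_sub k True True (S_a k a) (S_a k a).
           \<psi> (f \<circ> g) = \<psi> f \<circ> \<psi> g)) \<and>
     (\<exists>p\<in>Diff_sub k False False (S_a k a) (S_a k a).
        p \<circ> p = id \<and> p \<noteq> id \<and>
        (\<forall>f\<in>Diff k (S_a k a) (S_a k a). \<forall>n\<in>Diff_sub k True True (S_a k a) (S_a k a).
           f \<circ> n \<circ> inv f \<in> Diff_sub k True True (S_a k a) (S_a k a)) \<and>
        Diff k (S_a k a) (S_a k a) =
          {n \<circ> q | n q. n \<in> Diff_sub k True True (S_a k a) (S_a k a) \<and> q \<in> {id, p}} \<and>
        Diff_sub k True True (S_a k a) (S_a k a) \<inter> {id, p} = {id}) \<and>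
     (\<exists>(\<sigma> :: (real \<Rightarrow> real) \<Rightarrow> (real \<Rightarrow> real)) (\<Phi> :: (L \<Rightarrow> L) \<Rightarrow> (real \<Rightarrow> real) \<times> int).
        bij_betw \<sigma> (Ek_plus k) (Ek_plus k) \<and>
        (\<forall>u\<in>Ek_plus k. \<forall>v\<in>Ek_plus k. \<sigma> (u \<circ> v) = \<sigma> u \<circ> \<sigma> v) \<and>
        (\<forall>u\<in>Ek_plus k. \<sigma> (\<sigma> u) = u) \<and>
        bij_betw \<Phi> (Diff k (S_a k a) (S_a k a)) (Ek_plus k \<times> Z2) \<and>
        (\<forall>f\<in>Diff k (S_a k a) (S_a k a). \<forall>g\<in>Diff k (S_a k a) (S_a k a).
           \<Phi> (f \<circ> g) = (fst (\<Phi> f) \<circ> (if snd (\<Phi> f) = 1 then fst (\<Phi> g) else \<sigma> (fst (\<Phi> g))),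
                         snd (\<Phi> f) * snd (\<Phi> g)))))
   \<and>
  \<comment> \<open>(3)\<close>
  (\<forall>a::real. a > 0 \<and> a \<noteq> 1 \<longrightarrow>
     Diff k (S_a k a) (S_a k (1/a)) \<noteq> {} \<and>
     Diff_sub k True True (S_a k a) (S_a k (1/a)) = {} \<and>
     Diff_sub k False False (S_a k a) (S_a k (1/a)) = {} \<and>
     Diff k (S_a k a) (S_a k (1/a)) =
       Diff_sub k True False (S_a k a) (S_a k (1/a)) \<union> Diff_sub k False True (S_a k a) (S_a k (1/a)) \<and>
     Diff_sub k True False (S_a k a) (S_a k (1/a)) \<inter> Diff_sub k False True (S_a k a) (S_a k (1/a)) = {} \<and>
     (\<forall>h\<in>Diff_sub k False True (S_a k a) (S_a k (1/a)). \<forall>g\<in>Diff_sub k True False (S_a k a) (S_a k (1/a)).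
        bij_betw (\<lambda>\<kappa>. inv g \<circ> \<kappa>) (Diff_sub k True False (S_a k a) (S_a k (1/a)))
                                 (Diff_sub k True True (S_a k a) (S_a k a)) \<and>
        bij_betw (\<lambda>\<kappa>. h \<circ> \<kappa>) (Diff_sub k True True (S_a k a) (S_a k a))
                             (Diff_sub k False True (S_a k a) (S_a k (1/a)))))
   \<and>
  \<comment> \<open>(4)\<close>
  (\<forall>a b::real. a > 0 \<and> b > 0 \<and> a \<noteq> b \<and> a \<noteq> 1/b \<longrightarrow> Diff k (S_a k a) (S_a k b) = {}) \<and>
  (\<exists>\<A> :: chart set set set. uncountable \<A> \<and> (\<forall>S\<in>\<A>. is_Ck_structure k S) \<and>
     (\<forall>S\<in>\<A>. \<forall>T\<in>\<A>. S \<noteq> T \<longrightarrow> Diff k S T = {}))"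
proof (intro conjI[OF Diff_S_1_iso] conjI[OF _ uncountable_Ck_structures[OF k]] conjI allI impI;
    (elim conjE)?)
  fix a :: real assume a: "0 < a" "a \<noteq> 1"
  show "\<forall>h\<in>Diff_sub k False True (S_a k a) (S_a k (1/a)). \<forall>g\<in>Diff_sub k True False (S_a k a) (S_a k (1/a)).
        bij_betw (\<lambda>\<kappa>. inv g \<circ> \<kappa>) (Diff_sub k True False (S_a k a) (S_a k (1/a)))
                                 (Diff_sub k True True (S_a k a) (S_a k a)) \<and>
        bij_betw (\<lambda>\<kappa>. h \<circ> \<kappa>) (Diff_sub k True True (S_a k a) (S_a k a))
                             (Diff_sub k False True (S_a k a) (S_a k (1/a)))"
  proof (intro ballI conjI)
    fix h g assume h: "h \<in> Diff_sub k False True (S_a k a) (S_a k (1/a))"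
      and g: "g \<in> Diff_sub k True False (S_a k a) (S_a k (1/a))"
    have a': "1 / a > 0" using a(1) by simp
    show "bij_betw (\<lambda>\<kappa>. inv g \<circ> \<kappa>) (Diff_sub k True False (S_a k a) (S_a k (1/a)))
        (Diff_sub k True True (S_a k a) (S_a k a))"
      \<comment> \<open>\<open>inv g\<close> has the signs of \<open>g\<close>, so translating by it
        takes the component of \<open>g\<close> to the increasing, origin-fixing one.\<close>
      using bij_betw_comp_Diff_sub[OF a(1) a' a(1) Diff_sub_inv(1)[OF a(1) a' g], of True False] by simp
    show "bij_betw (\<lambda>\<kappa>. h \<circ> \<kappa>) (Diff_sub k True True (S_a k a) (S_a k a))
        (Diff_sub k False True (S_a k a) (S_a k (1/a)))"
      using bij_betw_comp_Diff_sub[OF a(1) a(1) a' h, of True True] by simp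
  qed
qed (fact Diff_S_a_a[OF k] Diff_sub_fix_iso_Ek_plus[OF k] Diff_S_a_semidirect[OF k]
    Diff_S_a_iso_semidirect[OF k] Diff_S_a_inverse[OF k] Diff_S_a_S_b_empty[OF k])+

end
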